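(* Let $M_0\ge 0$, $M_1\ge 0$, $\lambda\in\mathbb{R}$ with $M_0M_1-\lambda^2\ge 0$, and let $A=\begin{pmatrix} M_0&\lambda\\ \lambda& M_1\end{pmatrix}$, assumed not to be the zero matrix. Let $(Q_n^{\lambda})_{n\ge 0}$ be the monic orthogonal polynomials ($\deg Q_n^\lambda=n$) with respect to the inner product $$(P,Q)=\int_{\mathbb{R}}P(x)Q(x)e^{-x^2}\,dx+\begin{pmatrix}P(0)&P'(0)\end{pmatrix}A\begin{pmatrix}Q(0)\\ Q'(0)\end{pmatrix}.$$ In the diagonal case $\lambda=0$ write $Q_n$ for $Q_n^{0}$; the notation $Q_n^{\lambda}$ below refers to the nondiagonal case $\lambda\neq 0$ (so that $M_0>0$, $M_1>0$). Then the following limits hold, all of them uniformly on compact subsets of the complex plane. (a) Even degree. If $\lambda=0$, $$\lim_{n\to\infty}\frac{(-1)^n\sqrt n}{n!}\,Q_{2n}\!\left(\frac{x}{2\sqrt n}\right)=\begin{cases}\left(\frac x2\right)^{1/2}J_{-1/2}(x)&\text{if }\operatorname{rank}A=1,\ M_0=0,\\[2pt] -\left(\frac x2\right)^{1/2}J_{3/2}(x)&\text{if }\operatorname{rank}A=1,\ M_0>0,\\[2pt] -\left(\frac x2\right)^{1/2}J_{3/2}(x)&\text{if }\operatorname{rank}A=2.\end{cases}$$ If $\lambda\ne0$, $$\lim_{n\to\infty}\frac{(-1)^n\sqrt n}{n!}\,Q^{\lambda}_{2n}\!\left(\frac{x}{2\sqrt n}\right)=\begin{cases}\left(\frac x2\right)^{1/2}J_{-1/2}(x)&\text{if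 }\operatorname{rank}A=1,\\[2pt] -\left(\frac x2\right)^{1/2}J_{3/2}(x)&\text{if }\operatorname{rank}A=2.\end{cases}$$ (b) Odd degree. If $\lambda=0$, $$\lim_{n\to\infty}\frac{(-1)^n}{n!}\,Q_{2n+1}\!\left(\frac{x}{2\sqrt n}\right)=\begin{cases}\left(\frac x2\right)^{1/2}J_{1/2}(x)&\text{if }\operatorname{rank}A=1,\ M_1=0,\\[2pt] -\left(\frac x2\right)^{1/2}J_{5/2}(x)&\text{if }\operatorname{rank}A=1,\ M_1>0,\\[2pt] -\left(\frac x2\right)^{1/2}J_{5/2}(x)&\text{if }\operatorname{rank}A=2.\end{cases}$$ If $\lambda\neq0$, $$\lim_{n\to\infty}\frac{(-1)^n}{n!}\,Q^{\lambda}_{2n+1}\!\left(\frac{x}{2\sqrt n}\right)=\begin{cases}-\left(\frac x2\right)^{1/2}J_{5/2}(x)&\text{if }\operatorname{rank}A=1,\\[2pt] -\left(\frac x2\right)^{1/2}J_{5/2}(x)&\text{if }\operatorname{rank}A=2.\end{cases}$$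
   Context: For $\alpha\in\mathbb{R}$, $J_\alpha$ is the Bessel function of the first kind, $J_\alpha(z)=\sum_{m=0}^\infty\frac{(-1)^m}{m!\,\Gamma(m+\alpha+1)}\left(\frac z2\right)^{2m+\alpha}$. The function $\left(\frac x2\right)^{1/2}J_\alpha(x)$, for $\alpha\in\{-\frac12,\frac12,\frac32,\frac52\}$, denotes the entire function $\sum_{m=0}^\infty\frac{(-1)^m}{m!\,\Gamma(m+\alpha+1)}\left(\frac x2\right)^{2m+\alpha+1/2}$. Polynomials have real coefficients; the sequence of monic orthogonal polynomials is the unique one with $Q_n^{\lambda}$ monic of degree $n$ and orthogonal to all polynomials of degree less than $n$. *)

theory Defs
  imports "HOL-Analysis.Analysis" "HOL-Computational_Algebra.Polynomial"
begin

definition bessel_J :: "real \<Rightarrow> complex \<Rightarrow> complex" where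
  "bessel_J \<alpha> z =
     (\<Sum>m. (-1) ^ m / (fact m * of_real (Gamma (real m + \<alpha> + 1)))
          * (z / 2) powr of_real (2 * real m + \<alpha>))"

text \<open>
  The entire function denoted by \<open>(z/2)^(1/2) J\<^sub>\<alpha>(z)\<close>. It is meant for \<open>\<alpha> + 1/2\<close> a natural
  number, so that every exponent is a natural number and \<open>nat \<lfloor>_\<rfloor>\<close> only changes its type.
  Ordinary powers are used because \<open>powr\<close> would give the wrong value at \<open>z = 0\<close> for
  \<open>\<alpha> = -1/2\<close> (as \<open>0 powr 0 = 0\<close>). Away from \<open>0\<close> the function is the product of \<open>(z/2)^(1/2)\<close>
  and \<open>bessel_J \<alpha> z\<close>, see \<open>sqrt_bessel_J_eq\<close> below.
\<close>

definition sqrt_bessel_J :: "real \<Rightarrow> complex \<Rightarrow> complex" where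
  "sqrt_bessel_J \<alpha> z =
     (\<Sum>m. (-1) ^ m / (fact m * of_real (Gamma (real m + \<alpha> + 1)))
          * (z / 2) ^ nat \<lfloor>2 * real m + \<alpha> + 1 / 2\<rfloor>)"

lemma bessel_coeff_summable:
  fixes w :: complex
  assumes "\<alpha> \<ge> - 1 / 2"
  shows "summable (\<lambda>m. (-1) ^ m / (fact m * of_real (Gamma (real m + \<alpha> + 1))) * w ^ (2 * m))"
    (is "summable ?f")
proof -
  obtain N :: nat where N: "2 * (norm w)\<^sup>2 \<le> real N"
    using real_arch_simple by blast
  show ?thesis
  proof (rule summable_ratio_test[of "1/2" N])
    fix m assume m: "m \<ge> N"
    define a where "a = real m + \<alpha> + 1"
    have a: "a \<ge> 1/2" using assms by (simp add: a_def)
    have G: "Gamma (a + 1) = a * Gamma a"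
      using a by (intro Gamma_plus1) (auto elim!: nonpos_Ints_cases)
    have Gp: "Gamma a > 0" using a by (intro Gamma_real_pos) auto
    have nf: "norm (?f k) = norm w ^ (2*k) / (fact k * \<bar>Gamma (real k + \<alpha> + 1)\<bar>)" for k
      by (simp add: norm_mult norm_divide norm_power)
    have e: "real (Suc m) + \<alpha> + 1 = a + 1" by (simp add: a_def)
    have "norm (?f (Suc m)) = ((norm w)\<^sup>2 / (real (Suc m) * a)) * norm (?f m)"
      unfolding nf unfolding e using a Gp
      by (simp add: G a_def[symmetric] abs_mult power2_eq_square divide_simps del: of_nat_Suc)
    also have "\<dots> \<le> 1/2 * norm (?f m)"
    proof (rule mult_right_mono)
      have "4 * (norm w)\<^sup>2 \<le> real (Suc m) * (2 * a)"
      proof (cases "m = 0")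
        case True
        then have "N = 0" using m by simp
        then show ?thesis using N a by simp
      next
        case False
        then have "a \<ge> real m + 1/2" using assms by (simp add: a_def)
        moreover have "m \<ge> 1" using False by simp
        ultimately have "2 * a \<ge> 2" by linarith
        then have "real (Suc m) * 2 \<le> real (Suc m) * (2 * a)"
          by (intro mult_left_mono) auto
        moreover have "4 * (norm w)\<^sup>2 \<le> real (Suc m) * 2"
          using N m by (simp add: of_nat_mono)
        ultimately show ?thesis by linarith
      qed
      then show "(norm w)\<^sup>2 / (real (Suc m) * a) \<le> 1/2"
        using a by (simp add: divide_simps mult_ac del: of_nat_Suc)
    qed simp
    finally show "norm (?f (Suc m)) \<le> 1/2 * norm (?f m)" .
  qed simp
qed

lemma sqrt_bessel_J_eq:
  assumes "\<alpha> = real k - 1 / 2" and "z \<noteq> 0"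
  shows "sqrt_bessel_J \<alpha> z = (z / 2) powr (1 / 2) * bessel_J \<alpha> z"
proof -
  define w where "w = z / 2"
  have w: "w \<noteq> 0" using assms by (simp add: w_def)
  define c where "c = (\<lambda>m. (-1) ^ m / (fact m * of_real (Gamma (real m + \<alpha> + 1))) :: complex)"
  have s: "summable (\<lambda>m. c m * w ^ (2 * m))"
    unfolding c_def by (rule bessel_coeff_summable) (simp add: assms)
  have p: "w powr of_real (2 * real m + \<alpha>) = w powr of_real \<alpha> * w ^ (2 * m)" for m
  proof -
    have "w powr of_real (2 * real m + \<alpha>) = w powr of_real \<alpha> * w powr of_nat (2 * m)"
      by (simp add: powr_add[symmetric] add.commute)
    then show ?thesis by (metis powr_nat' w)
  qed
  have q: "w powr (1/2) * w powr of_real \<alpha> = w ^ k"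
  proof -
    have "w powr (1/2) * w powr of_real \<alpha> = w powr of_nat k"
      by (simp add: powr_add[symmetric] assms(1))
    then show ?thesis by (metis powr_nat' w)
  qed
  have fl: "nat \<lfloor>2 * real m + \<alpha> + 1 / 2\<rfloor> = 2 * m + k" for m
  proof -
    have "2 * real m + \<alpha> + 1 / 2 = real (2 * m + k)" by (simp add: assms(1))
    then show ?thesis by (metis floor_of_nat nat_int)
  qed
  have B: "bessel_J \<alpha> z = w powr of_real \<alpha> * (\<Sum>m. c m * w ^ (2 * m))"
    unfolding bessel_J_def w_def[symmetric] p
    by (subst suminf_mult[OF s, symmetric]) (simp add: c_def mult_ac)
  have "sqrt_bessel_J \<alpha> z = w ^ k * (\<Sum>m. c m * w ^ (2 * m))"
    unfolding sqrt_bessel_J_def w_def[symmetric] fl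
    by (subst suminf_mult[OF s, symmetric]) (simp add: c_def mult_ac power_add)
  then show ?thesis
    unfolding B w_def[symmetric] q[symmetric] by (simp add: mult_ac)
qed

definition sobolev_inner :: "real ^ 2 ^ 2 \<Rightarrow> real poly \<Rightarrow> real poly \<Rightarrow> real" where
  "sobolev_inner A P Q =
     (\<integral>x. poly P x * poly Q x * exp (- (x\<^sup>2)) \<partial>lborel)
     + (vector [poly P 0, poly (pderiv P) 0] :: real ^ 2)
       \<bullet> (A *v vector [poly Q 0, poly (pderiv Q) 0])"

definition monic_orthogonal_seq ::
  "(real poly \<Rightarrow> real poly \<Rightarrow> real) \<Rightarrow> (nat \<Rightarrow> real poly) \<Rightarrow> bool" where
  "monic_orthogonal_seq ip Q \<longleftrightarrow>
     (\<forall>n. degree (Q n) = n \<and> lead_coeff (Q n) = 1 \<and>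
          (\<forall>p. degree p < n \<longrightarrow> ip (Q n) p = 0))"

definition compactly_uniform_limit ::
  "(nat \<Rightarrow> complex \<Rightarrow> complex) \<Rightarrow> (complex \<Rightarrow> complex) \<Rightarrow> bool" where
  "compactly_uniform_limit f g \<longleftrightarrow> (\<forall>K. compact K \<longrightarrow> uniform_limit K f g sequentially)"

definition scaled_even :: "(nat \<Rightarrow> real poly) \<Rightarrow> nat \<Rightarrow> complex \<Rightarrow> complex" where
  "scaled_even Q n x =
     of_real ((-1) ^ n * sqrt (real n) / fact n)
     * poly (map_poly of_real (Q (2 * n))) (x / of_real (2 * sqrt (real n)))"

definition scaled_odd :: "(nat \<Rightarrow> real poly) \<Rightarrow> nat \<Rightarrow> complex \<Rightarrow> complex" where
  "scaled_odd Q n x =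
     of_real ((-1) ^ n / fact n)
     * poly (map_poly of_real (Q (2 * n + 1))) (x / of_real (2 * sqrt (real n)))"

end

theory Submission
  imports Defs "HOL-Probability.Distributions"
begin

text \<open>
  Write the mass part of the inner product as \<open>w p(0) + w' p'(0)\<close> with numbers \<open>w\<close>, \<open>w'\<close> depending
  on \<open>Q\<close>. Both functionals are represented, in the Gaussian inner product, by polynomial kernels
  (\<open>parity_kernel_reproducing\<close>). Hence \<open>Q\<close> plus \<open>w\<close> times the even kernel plus \<open>w'\<close> times the
  odd kernel is the monic Hermite polynomial, and evaluation at the origin yields a two by two linear
  system for \<open>w\<close>, \<open>w'\<close> (\<open>sobolev_polynomial_expansion\<close>).

  Hermite polynomials and kernels are all of the form \<open>x^e L(x\<^sup>2)\<close> with Laguerre polynomials \<open>L\<close>,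
  with parameter \<open>e - 1/2\<close> for the Hermite polynomials and \<open>e + 1/2\<close> for the kernels, where \<open>e\<close> is
  the parity. Orthogonality and reproducing property come from explicit coefficients and one
  Chu-Vandermonde type sum (\<open>alternating_binomial_Gamma_ratio\<close>). After rescaling, the coefficients
  converge to those of Bessel functions and are dominated by them, which gives uniform convergence on
  compact sets (\<open>laguerre_scaled_limit\<close>).

  It remains to find the limits of the coefficients. With \<open>s\<close> the diagonal value of the kernel of the
  same parity as the degree, \<open>t\<close> that of the other one, \<open>\<mu>\<close> and \<open>\<nu>\<close> the corresponding masses
  and \<open>\<Delta> = det A\<close>, the kernel of the same parity appears with the relative weight
  \<open>s (\<mu> + t \<Delta>) / (1 + s \<mu> + t \<nu> + s t \<Delta>)\<close>. The diagonal value is of order \<open>\<surd>n\<close> for the even and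
  \<open>n \<surd>n\<close> for the odd kernel. So the weight tends to \<open>1\<close> when \<open>\<Delta> > 0\<close>, when the only mass is \<open>\<mu>\<close>,
  or when the degree is odd and \<open>\<mu> > 0\<close>; it tends to \<open>0\<close> when \<open>\<mu> = 0\<close>, or when the degree is even,
  \<open>\<Delta> = 0\<close> and \<open>\<nu> > 0\<close>. The contribution of the kernel of opposite parity always tends to \<open>0\<close>.
  With weight \<open>0\<close> the limit is that of the Hermite polynomials, with index \<open>e - 1/2\<close>. With
  weight \<open>1\<close> the recurrence of Bessel functions (\<open>bessel_entire_contiguous\<close>) turns the difference into
  minus the function with index \<open>e + 3/2\<close>.
\<close>

section \<open>Moments of the Gaussian weight\<close>

definition gauss_moment :: "nat \<Rightarrow> real" where
  "gauss_moment k = (if even k then Gamma ((real k + 1) / 2) else 0)"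

definition gauss_int :: "real poly \<Rightarrow> real" where
  "gauss_int p = (\<integral>x. poly p x * exp (- (x\<^sup>2)) \<partial>lborel)"

lemma Gamma_real_plus1: "x > 0 \<Longrightarrow> Gamma (x + 1) = x * Gamma x" for x :: real
  by (intro Gamma_plus1) (auto elim!: nonpos_Ints_cases)

lemma Gamma_real_nonzero: "x > 0 \<Longrightarrow> Gamma x \<noteq> 0" for x :: real
  by (rule Gamma_real_pos[THEN less_imp_neq, symmetric])

lemma Gamma_nat_plus_half:
  "Gamma (real j + 1 / 2) = sqrt pi * fact (2 * j) / (2 ^ (2 * j) * fact j)"
proof (induction j)
  case (Suc j)
  have "Gamma (real (Suc j) + 1 / 2) = (real j + 1 / 2) * Gamma (real j + 1 / 2)"
    using Gamma_real_plus1[of "real j + 1 / 2"] by (simp add: algebra_simps)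
  also have "\<dots> = sqrt pi * fact (2 * Suc j) / (2 ^ (2 * Suc j) * fact (Suc j))"
    unfolding Suc.IH by (simp add: divide_simps) (simp add: algebra_simps)
  finally show ?case .
qed (simp add: Gamma_one_half_real)

lemma has_bochner_integral_gauss_power:
  "has_bochner_integral lborel (\<lambda>x::real. x ^ k * exp (- (x\<^sup>2))) (gauss_moment k)"
proof (cases "even k")
  case True
  then obtain j where k: "k = 2 * j" by (elim evenE)
  have "has_bochner_integral lborel (\<lambda>x::real. exp (- (x\<^sup>2)) * x ^ (2 * j))
          (2 *\<^sub>R (sqrt pi / 2 * (fact (2 * j) / (2 ^ (2 * j) * fact j))))"
    by (rule has_bochner_integral_even_function[OF gaussian_moment_even_pos]) simp
  moreover have "(real k + 1) / 2 = real j + 1 / 2" by (simp add: k field_simps)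
  ultimately show ?thesis
    unfolding gauss_moment_def using Gamma_nat_plus_half[of j] by (simp only: k) (simp add: mult_ac)
next
  case False
  then obtain j where k: "k = 2 * j + 1" by (elim oddE)
  have "has_bochner_integral lborel (\<lambda>x::real. exp (- (x\<^sup>2)) * x ^ (2 * j + 1)) 0"
    by (rule has_bochner_integral_odd_function[OF gaussian_moment_odd_pos]) simp
  then show ?thesis by (simp add: gauss_moment_def k mult_ac)
qed

lemma integrable_gauss_poly: "integrable lborel (\<lambda>x. poly p x * exp (- (x\<^sup>2)))" for p :: "real poly"
proof -
  have "integrable lborel (\<lambda>x. coeff p i * (x ^ i * exp (- (x\<^sup>2))))" for i
    using has_bochner_integral_gauss_power[of i] by (auto simp: has_bochner_integral_iff)
  then have "integrable lborel (\<lambda>x. \<Sum>i\<le>degree p. coeff p i * (x ^ i * exp (- (x\<^sup>2))))"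
    by (intro Bochner_Integration.integrable_sum)
  then show ?thesis by (simp add: poly_altdef sum_distrib_right mult.assoc)
qed

lemma gauss_int_add: "gauss_int (p + q) = gauss_int p + gauss_int q"
  using integrable_gauss_poly[of p] integrable_gauss_poly[of q]
  by (simp add: gauss_int_def distrib_right)

lemma gauss_int_smult: "gauss_int (smult c p) = c * gauss_int p"
  by (simp add: gauss_int_def mult.assoc)

lemma gauss_int_sum: "gauss_int (sum f S) = (\<Sum>i\<in>S. gauss_int (f i))"
proof (induction S rule: infinite_finite_induct)
qed (simp_all add: gauss_int_add, simp_all add: gauss_int_def)

lemma gauss_int_monom: "gauss_int (monom c k) = c * gauss_moment k"
proof -
  have "gauss_int (monom 1 k) = gauss_moment k"
    using has_bochner_integral_gauss_power[of k]
    by (simp add: gauss_int_def poly_monom has_bochner_integral_iff)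
  then show ?thesis using gauss_int_smult[of c "monom 1 k"] by (simp add: smult_monom)
qed

lemma gauss_int_mult_expand:
  assumes "degree p < N"
  shows "gauss_int (F * p) = (\<Sum>k<N. coeff p k * gauss_int (F * monom 1 k))"
proof -
  have "p = (\<Sum>k\<le>N - 1. monom (coeff p k) k)"
    using assms by (intro poly_as_sum_of_monoms'[symmetric]) simp
  also have "{..N - 1} = {..<N}" using assms by auto
  finally have "p = (\<Sum>k<N. smult (coeff p k) (monom 1 k))" by (simp add: smult_monom)
  then have "gauss_int (F * p) = gauss_int (\<Sum>k<N. smult (coeff p k) (F * monom 1 k))"
    by (metis (no_types, lifting) sum_distrib_left mult_smult_right sum.cong)
  then show ?thesis by (simp add: gauss_int_sum gauss_int_smult)
qed

text \<open>
A nonzero polynomial has finitely many roots, and finite sets are null sets.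
\<close>
lemma gauss_int_square_eq_0:
  assumes "gauss_int (p * p) = 0"
  shows "p = 0"
proof (rule ccontr)
  assume "p \<noteq> 0"
  then have "{x. poly p x = 0} \<in> null_sets lborel"
    by (intro finite_imp_null_set_lborel poly_roots_finite)
  then have "AE x in lborel. x \<notin> {x. poly p x = 0}" by (rule AE_not_in)
  moreover have "AE x in lborel. poly (p * p) x * exp (- (x\<^sup>2)) = 0"
    using assms integrable_gauss_poly[of "p * p"]
    by (subst integral_nonneg_eq_0_iff_AE[symmetric]) (auto simp: gauss_int_def)
  ultimately have "AE x in (lborel :: real measure). False"
    by eventually_elim auto
  then show False by (simp add: eventually_False ae_filter_eq_bot_iff)
qed

section \<open>Explicit orthogonal polynomials and reproducing kernels\<close>

text \<open>
A form of the Chu-Vandermonde identity, and the only summation formula the proof needs. The sum is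
an \<open>m\<close>-th difference, and one difference step maps \<open>\<Gamma>(i + c) / \<Gamma>(i + d)\<close> to
\<open>(d - c) \<Gamma>(i + c) / \<Gamma>(i + d + 1)\<close>, a function of the same kind with \<open>d\<close> raised by one. If
\<open>d - c = -j\<close> with \<open>j < m\<close> the right-hand side vanishes; this produces orthogonality. If \<open>d - c = 1\<close>
it equals \<open>m! \<Gamma>(c) / \<Gamma>(d + m)\<close>; this normalises the kernels.
\<close>
lemma alternating_binomial_Gamma_ratio:
  fixes c d :: real
  assumes "c > 0" "d > 0"
  shows "(\<Sum>i\<le>m. (-1) ^ i * real (m choose i) * (Gamma (real i + c) / Gamma (real i + d)))
         = pochhammer (d - c) m * Gamma c / Gamma (d + real m)"
  using assms
proof (induction m arbitrary: d)
  case (Suc m)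
  define S where "S f = (\<Sum>i\<le>m. (-1) ^ i * real (m choose i) * f i)" for f :: "nat \<Rightarrow> real"
  define g where "g d i = Gamma (real i + c) / Gamma (real i + d)" for d i
  have step: "g d i - g d (Suc i) = (d - c) * g (d + 1) i" for i
  proof -
    have "Gamma (real i + c + 1) = (real i + c) * Gamma (real i + c)"
      "Gamma (real i + d + 1) = (real i + d) * Gamma (real i + d)"
      using Suc.prems by (auto intro!: Gamma_real_plus1 add_nonneg_pos)
    moreover have "Gamma (real i + d) > 0" using Suc.prems by (intro Gamma_real_pos) auto
    ultimately show ?thesis using Suc.prems
      by (simp add: g_def add_ac divide_simps) (simp add: algebra_simps)
  qed
  have "(\<Sum>i\<le>Suc m. (-1) ^ i * real (Suc m choose i) * g d i)
      = g d 0 + (\<Sum>i\<le>m. (-1) ^ Suc i * real (Suc m choose Suc i) * g d (Suc i))"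
    by (subst sum.atMost_Suc_shift) simp
  also have "\<dots> = (g d 0 + (\<Sum>i\<le>m. (-1) ^ Suc i * real (m choose Suc i) * g d (Suc i)))
                 - S (\<lambda>i. g d (Suc i))"
    by (simp add: S_def sum.distrib[symmetric] sum_negf[symmetric] algebra_simps
             flip: sum_subtractf)
  also have "g d 0 + (\<Sum>i\<le>m. (-1) ^ Suc i * real (m choose Suc i) * g d (Suc i))
           = (\<Sum>i\<le>Suc m. (-1) ^ i * real (m choose i) * g d i)"
    by (subst sum.atMost_Suc_shift) simp
  also have "\<dots> = S (g d)" by (simp add: S_def)
  also have "S (g d) - S (\<lambda>i. g d (Suc i)) = S (\<lambda>i. (d - c) * g (d + 1) i)"
    by (simp add: S_def step[symmetric] right_diff_distrib flip: sum_subtractf)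
  also have "\<dots> = (d - c) * S (g (d + 1))"
    by (simp add: S_def sum_distrib_left mult_ac)
  also have "S (g (d + 1)) = pochhammer (d + 1 - c) m * Gamma c / Gamma (d + 1 + real m)"
    using Suc.IH[of "d + 1"] Suc.prems by (simp add: S_def g_def)
  finally show ?case by (simp add: g_def pochhammer_rec algebra_simps)
qed (simp)

text \<open>
Up to the factor \<open>m! / \<Gamma>(m + \<alpha> + 1)\<close> this is \<open>x^e L\<^sub>m\<^sup>(\<^sup>\<alpha>\<^sup>)(x\<^sup>2)\<close> with a Laguerre polynomial
\<open>L\<^sub>m\<^sup>(\<^sup>\<alpha>\<^sup>)\<close>. In this normalisation the coefficients converge to those of a Bessel function after
rescaling, with no further constant. The exponent \<open>e\<close> is meant to be \<open>0\<close> or \<open>1\<close>, so that it is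
the parity of the polynomial.
\<close>
definition parity_laguerre :: "nat \<Rightarrow> real \<Rightarrow> nat \<Rightarrow> real poly" where
  "parity_laguerre e \<alpha> m =
     (\<Sum>i\<le>m. monom ((-1) ^ i * real (m choose i) / Gamma (real i + \<alpha> + 1)) (2 * i + e))"

lemma gauss_int_parity_laguerre:
  assumes "\<alpha> > -1"
  shows "gauss_int (parity_laguerre e \<alpha> m * monom 1 k) =
     (if even (e + k) then pochhammer (\<alpha> + 1 - (real (e + k) + 1) / 2) m
          * Gamma ((real (e + k) + 1) / 2) / Gamma (\<alpha> + 1 + real m) else 0)"
proof -
  define c where "c = (real (e + k) + 1) / 2"
  have "gauss_int (parity_laguerre e \<alpha> m * monom 1 k) =
    (\<Sum>i\<le>m. (-1) ^ i * real (m choose i) / Gamma (real i + \<alpha> + 1) * gauss_moment (2 * i + e + k))"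
    by (simp add: parity_laguerre_def sum_distrib_right mult_monom gauss_int_sum gauss_int_monom)
  also have "\<dots> = (if even (e + k) then
    (\<Sum>i\<le>m. (-1) ^ i * real (m choose i) * (Gamma (real i + c) / Gamma (real i + (\<alpha> + 1)))) else 0)"
    by (auto intro!: sum.cong arg_cong[of _ _ Gamma] simp: gauss_moment_def c_def field_simps)
  also have "(\<Sum>i\<le>m. (-1) ^ i * real (m choose i) * (Gamma (real i + c) / Gamma (real i + (\<alpha> + 1))))
      = pochhammer (\<alpha> + 1 - c) m * Gamma c / Gamma (\<alpha> + 1 + real m)"
    using assms by (intro alternating_binomial_Gamma_ratio) (auto simp: c_def add_nonneg_pos)
  finally show ?thesis by (simp add: c_def)
qed

definition monic_hermite :: "nat \<Rightarrow> nat \<Rightarrow> real poly" where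
  "monic_hermite e m =
     smult ((-1) ^ m * Gamma (real m + real e + 1 / 2)) (parity_laguerre e (real e - 1 / 2) m)"

text \<open>
The Christoffel-Darboux kernel at the origin: for \<open>e = 0\<close> it represents \<open>p \<mapsto> p(0)\<close> and for
\<open>e = 1\<close> it represents \<open>p \<mapsto> p'(0)\<close>, both being \<open>coeff p e\<close>. Summing the Hermite expansion of the
kernel raises the Laguerre parameter by one compared with \<open>monic_hermite\<close>.
\<close>
definition parity_kernel :: "nat \<Rightarrow> nat \<Rightarrow> real poly" where
  "parity_kernel e m =
     smult (Gamma (real m + real e + 3 / 2) / (fact m * Gamma (real e + 1 / 2)))
       (parity_laguerre e (real e + 1 / 2) m)"

lemma coeff_parity_laguerre:
  "coeff (parity_laguerre e \<alpha> m) (2 * j + e) =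
     (-1) ^ j * real (m choose j) / Gamma (real j + \<alpha> + 1)"
  by (auto simp: parity_laguerre_def coeff_sum coeff_monom sum.delta not_le)

lemma coeff_parity_laguerre_eq_0:
  "odd (k + e) \<Longrightarrow> coeff (parity_laguerre e \<alpha> m) k = 0"
  unfolding parity_laguerre_def coeff_sum coeff_monom by (intro sum.neutral) auto

lemma degree_parity_laguerre_le: "degree (parity_laguerre e \<alpha> m) \<le> 2 * m + e"
  unfolding parity_laguerre_def
  by (intro degree_sum_le order.trans[OF degree_monom_le]) auto

lemma monic_hermite_degree_le: "degree (monic_hermite e m) \<le> 2 * m + e"
  unfolding monic_hermite_def by (rule order.trans[OF degree_smult_le degree_parity_laguerre_le])

lemma coeff_monic_hermite_top: "coeff (monic_hermite e m) (2 * m + e) = 1"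
proof -
  have "Gamma (real m + real e + 1 / 2) \<noteq> 0"
    by (intro Gamma_real_nonzero) simp
  then show ?thesis
    using coeff_parity_laguerre[of e "real e - 1 / 2" m m]
    by (simp add: monic_hermite_def power_mult_distrib[symmetric] add_ac)
qed

text \<open>
Only monomials \<open>x\<^sup>2\<^sup>j\<^sup>+\<^sup>e\<close> with \<open>j < m\<close> have the right parity to matter. For them the Gamma ratio in
\<open>alternating_binomial_Gamma_ratio\<close> is a polynomial of degree \<open>j\<close> in \<open>i\<close>, which is killed by
\<open>m\<close> differences.
\<close>
lemma monic_hermite_orthogonal:
  assumes "degree p < 2 * m + e" and "e \<le> 1"
  shows "gauss_int (monic_hermite e m * p) = 0"
proof -
  have "gauss_int (parity_laguerre e (real e - 1 / 2) m * monom 1 k) = 0"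
    if k: "k < 2 * m + e" for k
  proof (cases "even (e + k)")
    case True
    then have "k \<ge> e" using assms(2) by (cases "e = 0") (auto elim: oddE)
    with True obtain j where j: "k = 2 * j + e"
      by (metis add.commute dvd_diff_nat even_add evenE le_add_diff_inverse)
    have "real e - 1 / 2 + 1 - (real (e + k) + 1) / 2 = - real j"
      by (simp add: j field_simps)
    moreover have "j < m" using j k by simp
    ultimately show ?thesis
      by (simp add: gauss_int_parity_laguerre pochhammer_of_nat_eq_0_lemma)
  qed (simp add: gauss_int_parity_laguerre)
  then show ?thesis
    by (simp add: monic_hermite_def gauss_int_smult gauss_int_mult_expand[OF assms(1)])
qed

text \<open>
As for the Hermite polynomials, but the raised parameter shifts the degree to \<open>j - 1\<close>: the monomials
with \<open>1 \<le> j \<le> m\<close> are annihilated, while \<open>j = 0\<close> gives the Beta-type value that is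
normalised to one. The bound \<open>2 m + e + 2\<close> on the degree is one more than what \<open>j \<le> m\<close> suggests,
because the next monomial has the wrong parity.
\<close>
lemma parity_kernel_reproducing:
  assumes "degree p < 2 * m + e + 2" and "e \<le> 1"
  shows "gauss_int (parity_kernel e m * p) = coeff p e"
proof -
  define c where "c = Gamma (real m + real e + 3 / 2) / (fact m * Gamma (real e + 1 / 2))"
  have "c * gauss_int (parity_laguerre e (real e + 1 / 2) m * monom 1 k) = (if k = e then 1 else 0)"
    if k: "k < 2 * m + e + 2" for k
  proof (cases "even (e + k)")
    case True
    then have "k \<ge> e" using assms(2) by (cases "e = 0") (auto elim: oddE)
    with True obtain j where j: "k = 2 * j + e"
      by (metis add.commute dvd_diff_nat even_add evenE le_add_diff_inverse)
    have A: "real e + 1 / 2 + 1 - (real (e + k) + 1) / 2 = 1 - real j"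
      and B: "(real (e + k) + 1) / 2 = real j + real e + 1 / 2"
      by (simp_all add: j field_simps)
    have "j \<le> m" using j k by simp
    show ?thesis
    proof (cases j)
      case 0
      have "Gamma (real m + real e + 3 / 2) \<noteq> 0" "Gamma (real e + 1 / 2) \<noteq> 0"
        by (intro Gamma_real_nonzero; simp)+
      moreover have "gauss_int (parity_laguerre e (real e + 1 / 2) m * monom 1 k)
          = fact m * Gamma (real e + 1 / 2) / Gamma (real m + real e + 3 / 2)"
        using True by (simp only: gauss_int_parity_laguerre A B 0)
          (simp add: gauss_int_parity_laguerre A B 0 pochhammer_fact[symmetric] add_ac)
      ultimately show ?thesis using 0 j unfolding c_def by simp
    next
      case (Suc i)
      then have "i < m" using \<open>j \<le> m\<close> by simp
      then have "pochhammer (1 - real j) m = 0"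
        by (simp add: Suc pochhammer_of_nat_eq_0_lemma)
      then have "gauss_int (parity_laguerre e (real e + 1 / 2) m * monom 1 k) = 0"
        using A by (subst gauss_int_parity_laguerre) auto
      then show ?thesis using Suc j by simp
    qed
  qed (auto simp: gauss_int_parity_laguerre)
  note main = this
  have "gauss_int (parity_kernel e m * p) = c * gauss_int (parity_laguerre e (real e + 1 / 2) m * p)"
    by (simp add: parity_kernel_def gauss_int_smult c_def)
  also have "\<dots> = (\<Sum>k<2 * m + e + 2. coeff p k *
        (c * gauss_int (parity_laguerre e (real e + 1 / 2) m * monom 1 k)))"
    unfolding gauss_int_mult_expand[OF assms(1)] sum_distrib_left by (simp only: mult.left_commute)
  also have "\<dots> = (\<Sum>k<2 * m + e + 2. if k = e then coeff p k else 0)"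
    by (intro sum.cong) (auto simp: main)
  also have "\<dots> = coeff p e" by (subst sum.delta) auto
  finally show ?thesis .
qed

lemma monic_hermite_unique:
  assumes R: "degree R \<le> 2 * m + e" "coeff R (2 * m + e) = 1" and "e \<le> 1"
    and orth: "\<And>p. degree p < 2 * m + e \<Longrightarrow> gauss_int (R * p) = 0"
  shows "R = monic_hermite e m"
proof (cases "2 * m + e = 0")
  case True
  then show ?thesis using R monic_hermite_degree_le[of e m] coeff_monic_hermite_top[of e m]
    by (intro poly_eqI) (metis coeff_eq_0 gr0I le_zero_eq)
next
  case False
  define d where "d = R - monic_hermite e m"
  have "degree d \<le> 2 * m + e" unfolding d_def
    using R(1) monic_hermite_degree_le by (rule degree_diff_le)
  moreover have "coeff d (2 * m + e) = 0" by (simp add: d_def R(2) coeff_monic_hermite_top)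
  ultimately have deg: "degree d < 2 * m + e"
    using False by (metis degree_0 le_neq_implies_less leading_coeff_0_iff)
  have "R * d = monic_hermite e m * d + d * d" by (simp add: d_def algebra_simps)
  then have "gauss_int (d * d) = gauss_int (R * d) - gauss_int (monic_hermite e m * d)"
    by (simp add: gauss_int_add)
  then have "gauss_int (d * d) = 0"
    using orth[OF deg] monic_hermite_orthogonal[OF deg \<open>e \<le> 1\<close>] by simp
  then show ?thesis using gauss_int_square_eq_0[of d] by (simp add: d_def)
qed

section \<open>The Sobolev polynomials in terms of the kernels\<close>

lemma parity_kernel_degree_le: "degree (parity_kernel e m) \<le> 2 * m + e"
  unfolding parity_kernel_def by (rule order.trans[OF degree_smult_le degree_parity_laguerre_le])

lemma coeff_parity_kernel_diag:
  "coeff (parity_kernel e m) e =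
     Gamma (real m + real e + 3 / 2) / (fact m * Gamma (real e + 1 / 2) * Gamma (real e + 3 / 2))"
  using coeff_parity_laguerre[of e "real e + 1 / 2" m 0] by (simp add: parity_kernel_def add_ac)

lemma coeff_parity_kernel_diag_pos: "coeff (parity_kernel e m) e > 0"
  unfolding coeff_parity_kernel_diag
  by (intro divide_pos_pos mult_pos_pos Gamma_real_pos) auto

lemma parity_kernel_eq_smult:
  "parity_kernel e m =
     smult (coeff (parity_kernel e m) e * Gamma (real e + 3 / 2)) (parity_laguerre e (real e + 1 / 2) m)"
  using Gamma_real_nonzero[of "real e + 3 / 2"]
  unfolding coeff_parity_kernel_diag by (simp add: parity_kernel_def)

text \<open>
The linear system that determines the multipliers \<open>w\<close>, \<open>w'\<close> of the two kernels. Here \<open>s\<close>, \<open>t\<close> are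
the diagonal values of the kernels, \<open>\<mu>\<close>, \<open>\<nu>\<close> the masses they are paired with, and \<open>h\<close> is
the value on the Hermite polynomial of that one of the two functionals which its parity does not
force to vanish.
\<close>
lemma two_mass_system_solution:
  fixes s t \<mu> \<nu> lam h w w' :: real
  assumes "w = \<mu> * (h - w * s) - lam * (w' * t)" and "w' = lam * (h - w * s) - \<nu> * (w' * t)"
  shows "w * (1 + s * \<mu> + t * \<nu> + s * t * (\<mu> * \<nu> - lam\<^sup>2)) = h * (\<mu> + t * (\<mu> * \<nu> - lam\<^sup>2))"
    and "w' * (1 + s * \<mu> + t * \<nu> + s * t * (\<mu> * \<nu> - lam\<^sup>2)) = h * lam"
proof -
  have a1: "w * (1 + s * \<mu>) = \<mu> * h - lam * t * w'" and a2: "w' * (1 + t * \<nu>) = lam * h - lam * s * w"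
    using assms by (simp_all add: algebra_simps)
  have "w * (1 + s * \<mu> + t * \<nu> + s * t * (\<mu> * \<nu> - lam\<^sup>2))
      = (1 + t * \<nu>) * (w * (1 + s * \<mu>)) - lam\<^sup>2 * s * t * w" by (simp add: algebra_simps)
  also have "\<dots> = (1 + t * \<nu>) * \<mu> * h - lam * t * (w' * (1 + t * \<nu>)) - lam\<^sup>2 * s * t * w"
    unfolding a1 by (simp add: algebra_simps)
  also have "\<dots> = h * (\<mu> + t * (\<mu> * \<nu> - lam\<^sup>2))"
    unfolding a2 by (simp add: algebra_simps power2_eq_square)
  finally show "w * (1 + s * \<mu> + t * \<nu> + s * t * (\<mu> * \<nu> - lam\<^sup>2)) = h * (\<mu> + t * (\<mu> * \<nu> - lam\<^sup>2))" .
  have "w' * (1 + s * \<mu> + t * \<nu> + s * t * (\<mu> * \<nu> - lam\<^sup>2))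
      = (1 + s * \<mu>) * (w' * (1 + t * \<nu>)) - lam\<^sup>2 * s * t * w'" by (simp add: algebra_simps)
  also have "\<dots> = (1 + s * \<mu>) * lam * h - lam * s * (w * (1 + s * \<mu>)) - lam\<^sup>2 * s * t * w'"
    unfolding a2 by (simp add: algebra_simps)
  also have "\<dots> = h * lam"
    unfolding a1 by (simp add: algebra_simps power2_eq_square)
  finally show "w' * (1 + s * \<mu> + t * \<nu> + s * t * (\<mu> * \<nu> - lam\<^sup>2)) = h * lam" .
qed

text \<open>
The determinant of \<open>1 + A diag(s, t)\<close> for the mass matrix \<open>A\<close> with diagonal \<open>\<mu>\<close>, \<open>\<nu>\<close> and
off-diagonal entry \<open>lam\<close>.
\<close>
definition mass_det :: "real \<Rightarrow> real \<Rightarrow> real \<Rightarrow> real \<Rightarrow> real \<Rightarrow> real" where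
  "mass_det \<mu> \<nu> lam s t = 1 + s * \<mu> + t * \<nu> + s * t * (\<mu> * \<nu> - lam\<^sup>2)"

lemma mass_det_pos:
  assumes "\<mu> \<ge> 0" "\<nu> \<ge> 0" "\<mu> * \<nu> - lam\<^sup>2 \<ge> 0" "s \<ge> 0" "t \<ge> 0"
  shows "mass_det \<mu> \<nu> lam s t > 0"
  unfolding mass_det_def using assms by (intro add_pos_nonneg mult_nonneg_nonneg) auto

text \<open>
The mass part of the inner product is the same functional of \<open>p\<close> as the Gaussian inner product of
\<open>p\<close> with a combination of the two kernels. Adding this combination to \<open>Q\<close> therefore gives a monic
polynomial orthogonal in the Gaussian sense, which is the Hermite polynomial; evaluating at the origin
gives the linear system for the coefficients. Even and odd degrees are treated together: \<open>e\<close> is the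
parity of the degree, \<open>\<mu>\<close> the mass attached to the functional \<open>coeff _ e\<close> of the same parity and
\<open>\<nu>\<close> the mass of the opposite parity. The kernel of opposite parity enters only through \<open>lam\<close>.
\<close>
lemma sobolev_polynomial_expansion:
  fixes \<mu> \<nu> lam :: real and Q :: "real poly"
  assumes e: "e \<le> 1" and n: "n \<ge> 1"
    and pos: "\<mu> \<ge> 0" "\<nu> \<ge> 0" "\<mu> * \<nu> - lam\<^sup>2 \<ge> 0"
    and Q: "degree Q \<le> 2 * n + e" "coeff Q (2 * n + e) = 1"
    and orth: "\<And>p. degree p < 2 * n + e \<Longrightarrow>
       gauss_int (Q * p) + (\<mu> * coeff Q e + lam * coeff Q (1 - e)) * coeff p e
         + (lam * coeff Q e + \<nu> * coeff Q (1 - e)) * coeff p (1 - e) = 0"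
  defines "s \<equiv> coeff (parity_kernel e (n - 1)) e"
    and "t \<equiv> coeff (parity_kernel (1 - e) (n - 1 + e)) (1 - e)"
  shows "Q = smult ((-1) ^ n * Gamma (real n + real e + 1 / 2))
     (parity_laguerre e (real e - 1 / 2) n
      - smult (s * (\<mu> + t * (\<mu> * \<nu> - lam\<^sup>2)) / mass_det \<mu> \<nu> lam s t * (real e + 1 / 2))
          (parity_laguerre e (real e + 1 / 2) (n - 1))
      - smult (lam * t / mass_det \<mu> \<nu> lam s t * Gamma (real (1 - e) + 3 / 2) / Gamma (real e + 1 / 2))
          (parity_laguerre (1 - e) (real (1 - e) + 1 / 2) (n - 1 + e)))"
proof -
  define f where "f = 1 - e"
  have f: "f \<le> 1" and odd_ef: "odd (e + f)" "odd (f + e)" using e by (auto simp: f_def)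
  define K where "K = parity_kernel e (n - 1)"
  define L where "L = parity_kernel f (n - 1 + e)"
  define w where "w = \<mu> * coeff Q e + lam * coeff Q f"
  define w' where "w' = lam * coeff Q e + \<nu> * coeff Q f"
  define H where "H = monic_hermite e n"
  define D where "D = mass_det \<mu> \<nu> lam s t"
  have st: "s > 0" "t > 0" by (simp_all add: s_def t_def coeff_parity_kernel_diag_pos)
  have D: "D > 0" unfolding D_def using pos st by (intro mass_det_pos) auto
  have degK: "degree K < 2 * n + e"
    using parity_kernel_degree_le[of e "n - 1"] n by (simp add: K_def)
  have degL: "degree L < 2 * n + e"
    using parity_kernel_degree_le[of f "n - 1 + e"] n e by (simp add: L_def f_def)
  define R where "R = Q + smult w K + smult w' L"
  have "R = H" unfolding H_def
  proof (rule monic_hermite_unique[OF _ _ e])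
    show "degree R \<le> 2 * n + e" unfolding R_def using Q(1) degK degL
      by (intro degree_add_le order.trans[OF degree_smult_le]) auto
    show "coeff R (2 * n + e) = 1" unfolding R_def using Q(2) degK degL by (simp add: coeff_eq_0)
    fix p :: "real poly" assume p: "degree p < 2 * n + e"
    have "gauss_int (K * p) = coeff p e" "gauss_int (L * p) = coeff p f"
      unfolding K_def L_def using p n e f by (auto intro!: parity_kernel_reproducing simp: f_def)
    moreover have "R * p = Q * p + (smult w (K * p) + smult w' (L * p))"
      by (simp add: R_def algebra_simps)
    ultimately have "gauss_int (R * p) = gauss_int (Q * p) + w * coeff p e + w' * coeff p f"
      by (simp add: gauss_int_add gauss_int_smult)
    then show "gauss_int (R * p) = 0" using orth[OF p] by (simp add: w_def w'_def f_def)
  qed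
  then have Q_eq: "Q = H - smult w K - smult w' L" by (simp add: R_def algebra_simps)
  define h where "h = coeff H e"
  have "coeff K f = 0" "coeff L e = 0" "coeff H f = 0" using odd_ef
    by (simp_all add: K_def L_def H_def parity_kernel_def monic_hermite_def coeff_parity_laguerre_eq_0)
  moreover have "coeff K e = s" "coeff L f = t" by (simp_all add: K_def L_def s_def t_def f_def)
  ultimately have qe: "coeff Q e = h - w * s" and qf: "coeff Q f = - (w' * t)"
    by (simp_all add: Q_eq h_def)
  have "w = \<mu> * (h - w * s) - lam * (w' * t)" "w' = lam * (h - w * s) - \<nu> * (w' * t)"
    using w_def w'_def unfolding qe qf by linarith+
  from two_mass_system_solution[OF this] D
  have w: "w = h * (\<mu> + t * (\<mu> * \<nu> - lam\<^sup>2)) / D" and w': "w' = h * lam / D"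
    by (simp_all add: D_def mass_det_def field_simps)
  define c where "c = (-1) ^ n * Gamma (real n + real e + 1 / 2)"
  have h: "h = c / Gamma (real e + 1 / 2)"
    using coeff_parity_laguerre[of e "real e - 1 / 2" n 0]
    by (simp add: h_def H_def monic_hermite_def c_def add.commute)
  have K: "K = smult (s * Gamma (real e + 3 / 2)) (parity_laguerre e (real e + 1 / 2) (n - 1))"
    unfolding K_def s_def by (rule parity_kernel_eq_smult)
  have L: "L = smult (t * Gamma (real f + 3 / 2)) (parity_laguerre f (real f + 1 / 2) (n - 1 + e))"
    unfolding L_def t_def f_def by (rule parity_kernel_eq_smult)
  have G: "Gamma (real e + 3 / 2) = (real e + 1 / 2) * Gamma (real e + 1 / 2)"
    using Gamma_real_plus1[of "real e + 1 / 2"] by (simp add: add_ac)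
  have G0: "Gamma (real e + 1 / 2) \<noteq> 0" by (rule Gamma_real_nonzero) simp
  have wK: "w * (s * Gamma (real e + 3 / 2)) =
      c * (s * (\<mu> + t * (\<mu> * \<nu> - lam\<^sup>2)) / D * (real e + 1 / 2))"
    unfolding w h G using G0 by simp
  have wL: "w' * (t * Gamma (real f + 3 / 2)) =
      c * (lam * t / D * Gamma (real f + 3 / 2) / Gamma (real e + 1 / 2))"
    unfolding w' h by (simp add: mult_ac)
  have "H = smult c (parity_laguerre e (real e - 1 / 2) n)"
    by (simp add: H_def monic_hermite_def c_def)
  then show ?thesis
    unfolding Q_eq K L smult_smult wK wL c_def[symmetric] D_def[symmetric] f_def[symmetric]
    by (simp only: smult_diff_right smult_smult)
qed

lemma sobolev_inner_eq:
  assumes "A = vector [vector [M0, lam], vector [lam, M1]]"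
  shows "sobolev_inner A P Q = gauss_int (P * Q)
    + (M0 * coeff P 0 + lam * coeff P 1) * coeff Q 0 + (lam * coeff P 0 + M1 * coeff P 1) * coeff Q 1"
  by (simp add: sobolev_inner_def gauss_int_def assms inner_vec_def sum_2 matrix_vector_mult_def
      poly_0_coeff_0 coeff_pderiv algebra_simps)

section \<open>Mehler-Heine limits of rescaled Laguerre polynomials\<close>

text \<open>
Tannery's theorem for uniform limits: on the set \<open>K\<close> the error is bounded by the sum of
\<open>norm (a n i - b i) * r ^ i\<close>, to which the theorem for numerical series applies.
\<close>
lemma uniform_limit_power_series_dominated:
  fixes a :: "nat \<Rightarrow> nat \<Rightarrow> complex" and y :: "'a \<Rightarrow> complex"
  assumes lim: "\<And>i. (\<lambda>n. a n i) \<longlonglongrightarrow> b i"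
    and bound: "\<And>n i. norm (a n i) \<le> C i"
    and sum: "summable (\<lambda>i. C i * r ^ i)"
    and y: "\<And>x. x \<in> K \<Longrightarrow> norm (y x) \<le> r" and r: "r \<ge> 0"
  shows "uniform_limit K (\<lambda>n x. \<Sum>i. a n i * y x ^ i) (\<lambda>x. \<Sum>i. b i * y x ^ i) sequentially"
proof -
  have bC: "norm (b i) \<le> C i" for i
    by (rule Lim_bounded[OF tendsto_norm[OF lim]]) (use bound in auto)
  have C0: "C i \<ge> 0" for i using norm_ge_zero bound order.trans by blast
  define d where "d i n = norm (a n i - b i) * r ^ i" for i n
  have d_le: "norm (d i n) \<le> 2 * (C i * r ^ i)" for i n
  proof -
    have "norm (a n i - b i) \<le> C i + C i"
      by (rule norm_triangle_le_diff) (intro add_mono bound bC)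
    then have "norm (a n i - b i) * r ^ i \<le> (C i + C i) * r ^ i"
      by (rule mult_right_mono) (use r in simp)
    then show ?thesis using r by (simp add: d_def)
  qed
  have sum2: "summable (\<lambda>i. 2 * (C i * r ^ i))" by (rule summable_mult[OF sum])
  have "((\<lambda>n. \<Sum>i. d i n) \<longlongrightarrow> (\<Sum>i. 0)) sequentially"
  proof (rule tannerys_theorem[THEN conjunct2, THEN conjunct2])
    show "(d i \<longlongrightarrow> 0) sequentially" for i
    proof -
      have "(\<lambda>n. norm (a n i - b i) * r ^ i) \<longlonglongrightarrow> norm (b i - b i) * r ^ i"
        by (intro tendsto_intros lim)
      then show ?thesis by (simp add: d_def[abs_def])
    qed
    show "\<forall>\<^sub>F (i, n) in sequentially \<times>\<^sub>F sequentially. norm (d i n) \<le> 2 * (C i * r ^ i)"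
      using d_le by (intro always_eventually) auto
  qed (use sum2 in auto)
  then have D0: "(\<lambda>n. \<Sum>i. d i n) \<longlonglongrightarrow> 0" by simp
  show ?thesis
  proof (rule uniform_limitI)
    fix \<epsilon> :: real assume "\<epsilon> > 0"
    with D0 have "\<forall>\<^sub>F n in sequentially. (\<Sum>i. d i n) < \<epsilon>"
      by (rule order_tendstoD)
    then show "\<forall>\<^sub>F n in sequentially. \<forall>x\<in>K. dist (\<Sum>i. a n i * y x ^ i) (\<Sum>i. b i * y x ^ i) < \<epsilon>"
    proof (eventually_elim, intro ballI)
      fix n x assume n: "(\<Sum>i. d i n) < \<epsilon>" and x: "x \<in> K"
      have yr: "norm (y x ^ i) \<le> r ^ i" for i
        using y[OF x] by (simp add: norm_power power_mono)
      have sa: "summable (\<lambda>i. a n i * y x ^ i)" and sb: "summable (\<lambda>i. b i * y x ^ i)"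
        by (rule summable_comparison_test'[OF sum, of 0],
            auto simp: norm_mult intro!: mult_mono yr bC bound C0)+
      have "(\<Sum>i. a n i * y x ^ i) - (\<Sum>i. b i * y x ^ i) = (\<Sum>i. (a n i - b i) * y x ^ i)"
        by (simp add: suminf_diff[OF sa sb] left_diff_distrib)
      moreover have "norm (\<Sum>i. (a n i - b i) * y x ^ i) \<le> (\<Sum>i. d i n)"
      proof (rule norm_suminf_le)
        show "norm ((a n i - b i) * y x ^ i) \<le> d i n" for i
          unfolding d_def norm_mult by (intro mult_left_mono yr) simp
        show "summable (\<lambda>i. d i n)"
          by (rule summable_comparison_test'[OF sum2, of 0]) (use d_le in auto)
      qed
      ultimately show "dist (\<Sum>i. a n i * y x ^ i) (\<Sum>i. b i * y x ^ i) < \<epsilon>"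
        using n by (simp add: dist_norm)
    qed
  qed
qed

text \<open>
The even entire function \<open>(z/2)\<^sup>-\<^sup>\<alpha> J\<^sub>\<alpha>(z)\<close>. Removing the power keeps all exponents in the series
even.
\<close>
definition bessel_entire :: "real \<Rightarrow> complex \<Rightarrow> complex" where
  "bessel_entire \<alpha> z =
     (\<Sum>i. (-1) ^ i / (fact i * of_real (Gamma (real i + \<alpha> + 1))) * (z / 2) ^ (2 * i))"

lemma sqrt_bessel_J_eq_bessel_entire:
  assumes "\<alpha> = real k - 1 / 2"
  shows "sqrt_bessel_J \<alpha> z = (z / 2) ^ k * bessel_entire \<alpha> z"
proof -
  have fl: "nat \<lfloor>2 * real m + \<alpha> + 1 / 2\<rfloor> = 2 * m + k" for m
  proof -
    have "2 * real m + \<alpha> + 1 / 2 = real (2 * m + k)" by (simp add: assms)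
    then show ?thesis by (metis floor_of_nat nat_int)
  qed
  have "\<alpha> \<ge> - 1 / 2" by (simp add: assms)
  from suminf_mult[OF bessel_coeff_summable[OF this], of "(z / 2) ^ k" "z / 2"] show ?thesis
    unfolding sqrt_bessel_J_def bessel_entire_def fl by (simp add: power_add mult_ac)
qed

text \<open>
Equivalent to the three-term recurrence
\<open>J\<^sub>\<alpha>(z) + J\<^sub>\<alpha>\<^sub>+\<^sub>2(z) = 2 (\<alpha> + 1) J\<^sub>\<alpha>\<^sub>+\<^sub>1(z) / z\<close>. It turns the difference of two limits,
that of the Hermite polynomial and that of its kernel correction, into a single Bessel function
whose index is raised by two. The coefficients differ by a factor \<open>i\<close>, which cancels against
\<open>i!\<close> and shifts the series by one place.
\<close>
lemma bessel_entire_contiguous: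
  assumes "\<alpha> \<ge> - 1 / 2"
  shows "bessel_entire \<alpha> z - of_real (\<alpha> + 1) * bessel_entire (\<alpha> + 1) z
         = - ((z / 2)\<^sup>2 * bessel_entire (\<alpha> + 2) z)"
proof -
  define w where "w = z / 2"
  define q where "q \<beta> i = (-1) ^ i / (fact i * Gamma (real i + \<beta> + 1))" for \<beta> i
  define c where "c \<beta> i = of_real (q \<beta> i) * w ^ (2 * i)" for \<beta> i
  have c_eq: "c \<beta> i = (-1) ^ i / (fact i * of_real (Gamma (real i + \<beta> + 1))) * w ^ (2 * i)"
    for \<beta> i by (simp add: c_def q_def)
  have s: "summable (c \<beta>)" if "\<beta> \<ge> - 1 / 2" for \<beta>
    unfolding c_eq[abs_def] by (rule bessel_coeff_summable[OF that])
  have E: "bessel_entire \<beta> z = (\<Sum>i. c \<beta> i)" for \<beta> by (simp add: bessel_entire_def c_eq w_def)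
  define t where "t i = c \<alpha> i - of_real (\<alpha> + 1) * c (\<alpha> + 1) i" for i
  have t_eq: "t i = of_real (q \<alpha> i - (\<alpha> + 1) * q (\<alpha> + 1) i) * w ^ (2 * i)" for i
    by (simp add: t_def c_def algebra_simps)
  have q_diff: "q \<alpha> i - (\<alpha> + 1) * q (\<alpha> + 1) i = real i * (-1) ^ i / (fact i * Gamma (real i + \<alpha> + 2))" for i
  proof -
    have "Gamma (real i + \<alpha> + 2) = (real i + \<alpha> + 1) * Gamma (real i + \<alpha> + 1)"
      using Gamma_real_plus1[of "real i + \<alpha> + 1"] assms by (simp add: add_ac)
    moreover have "Gamma (real i + \<alpha> + 1) \<noteq> 0" "real i + \<alpha> + 1 \<noteq> 0"
      using assms by (auto intro!: Gamma_real_nonzero)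
    moreover have "real i + (\<alpha> + 1) + 1 = real i + \<alpha> + 2" by simp
    ultimately show ?thesis unfolding q_def
      by (simp only:) (simp add: divide_simps, simp add: algebra_simps)
  qed
  have t0: "t 0 = 0" by (simp add: t_eq q_diff)
  have tS: "t (Suc i) = - (w\<^sup>2 * c (\<alpha> + 2) i)" for i
  proof -
    have "real (Suc i) + \<alpha> + 2 = real i + (\<alpha> + 2) + 1" by simp
    then have "real (Suc i) * (-1) ^ Suc i / (fact (Suc i) * Gamma (real (Suc i) + \<alpha> + 2)) = - q (\<alpha> + 2) i"
      unfolding q_def by (simp only:) (simp add: divide_simps)
    then show ?thesis
      unfolding t_eq q_diff by (simp add: c_def power2_eq_square)
  qed
  have "(\<Sum>i. t i) = (\<Sum>i. t (Suc i))"
  proof -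
    have "summable t"
      unfolding t_def[abs_def] using s[of \<alpha>] s[of "\<alpha> + 1"] assms
      by (intro summable_diff summable_mult) auto
    then show ?thesis using t0 by (simp add: suminf_split_head)
  qed
  also have "\<dots> = - (w\<^sup>2 * (\<Sum>i. c (\<alpha> + 2) i))"
    using s[of "\<alpha> + 2"] assms by (simp add: tS suminf_minus suminf_mult summable_mult)
  finally show ?thesis
    using s[of \<alpha>] s[of "\<alpha> + 1"] assms
    by (simp add: t_def E w_def suminf_diff[symmetric] suminf_mult summable_mult)
qed

lemma binomial_over_power_tendsto:
  assumes "(\<lambda>n. real (m n) / real n) \<longlonglongrightarrow> 1"
  shows "(\<lambda>n. real (m n choose i) / real n ^ i) \<longlonglongrightarrow> 1 / fact i"
proof -
  have "(\<lambda>n. (\<Prod>j = 0..<i. real (m n) / real n - real j / real n) / fact i)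
      \<longlonglongrightarrow> (\<Prod>j = 0..<i. 1 - 0) / fact i"
    by (intro tendsto_intros assms tendsto_divide_0[OF tendsto_const] filterlim_at_top_imp_at_infinity
        filterlim_real_sequentially) auto
  moreover have "(\<Prod>j = 0..<i. real (m n) / real n - real j / real n) / fact i
      = real (m n choose i) / real n ^ i" for n
    by (simp add: binomial_gbinomial gbinomial_prod_rev diff_divide_distrib[symmetric] prod_dividef)
  ultimately show ?thesis by simp
qed

text \<open>
The polynomial \<open>parity_laguerre 0 \<alpha> m\<close> at \<open>z / (2 \<surd>n)\<close>, see \<open>poly_parity_laguerre_scaled\<close>; the
degree parameter \<open>m\<close> and the scaling parameter \<open>n\<close> are separate because the kernels have
\<open>m = n - 1\<close> or \<open>m = n\<close>.
\<close>
definition laguerre_scaled :: "real \<Rightarrow> nat \<Rightarrow> nat \<Rightarrow> complex \<Rightarrow> complex" where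
  "laguerre_scaled \<alpha> m n z =
     (\<Sum>i\<le>m. of_real ((-1) ^ i * real (m choose i) / real n ^ i / Gamma (real i + \<alpha> + 1))
        * (z / 2) ^ (2 * i))"

text \<open>
The coefficients converge since \<open>m choose i \<approx> n^i / i!\<close>, and they are dominated by those of the limit
because \<open>(m choose i) * i! \<le> n^i\<close> for \<open>m \<le> n\<close>.
\<close>
lemma laguerre_scaled_limit:
  assumes \<alpha>: "\<alpha> \<ge> - 1 / 2" and m: "\<And>n. m n \<le> n" "(\<lambda>n. real (m n) / real n) \<longlonglongrightarrow> 1"
    and K: "compact K"
  shows "uniform_limit K (\<lambda>n. laguerre_scaled \<alpha> (m n) n) (bessel_entire \<alpha>) sequentially"
proof -
  obtain R where R: "R > 0" "\<And>x. x \<in> K \<Longrightarrow> norm x \<le> R"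
    using compact_imp_bounded[OF K] bounded_pos by blast
  define b :: "nat \<Rightarrow> complex" where
    "b i = (-1) ^ i / (fact i * of_real (Gamma (real i + \<alpha> + 1)))" for i
  define a :: "nat \<Rightarrow> nat \<Rightarrow> complex" where
    "a n i = of_real ((-1) ^ i * real (m n choose i) / real n ^ i / Gamma (real i + \<alpha> + 1))" for n i
  have "uniform_limit K (\<lambda>n x. \<Sum>i. a n i * ((x / 2)\<^sup>2) ^ i) (\<lambda>x. \<Sum>i. b i * ((x / 2)\<^sup>2) ^ i) sequentially"
  proof (rule uniform_limit_power_series_dominated[where C = "\<lambda>i. norm (b i)" and r = "(R / 2)\<^sup>2"])
    fix i
    have "(\<lambda>n. (-1) ^ i * (real (m n choose i) / real n ^ i) / Gamma (real i + \<alpha> + 1))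
      \<longlonglongrightarrow> (-1) ^ i * (1 / fact i) / Gamma (real i + \<alpha> + 1)"
      using \<alpha> by (intro tendsto_divide tendsto_mult tendsto_const binomial_over_power_tendsto m(2)
          Gamma_real_nonzero) auto
    then have "(\<lambda>n. a n i) \<longlonglongrightarrow> of_real ((-1) ^ i * (1 / fact i) / Gamma (real i + \<alpha> + 1))"
      unfolding a_def by (intro tendsto_of_real) simp
    then show "(\<lambda>n. a n i) \<longlonglongrightarrow> b i" by (simp add: b_def)
  next
    fix n i
    have "(m n choose i) * fact i \<le> n ^ i"
      using binomial_fact_pow[of "m n" i] power_mono[OF m(1)[of n], of i] by linarith
    then have "real ((m n choose i) * fact i) \<le> real (n ^ i)" by (rule of_nat_mono)
    then have le: "real (m n choose i) * fact i \<le> real n ^ i" by simp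
    have "real (m n choose i) / real n ^ i \<le> 1 / fact i"
    proof (cases "real n ^ i = 0")
      case True
      show ?thesis unfolding True by simp
    next
      case False
      then have "real n ^ i > 0" using zero_le_power[of "real n" i] by linarith
      moreover have "real (m n choose i) \<le> real n ^ i / fact i"
        using le by (subst pos_le_divide_eq) auto
      ultimately show ?thesis by (intro mult_imp_div_pos_le) auto
    qed
    then have "real (m n choose i) / real n ^ i / \<bar>Gamma (real i + \<alpha> + 1)\<bar>
       \<le> 1 / fact i / \<bar>Gamma (real i + \<alpha> + 1)\<bar>" by (intro divide_right_mono) auto
    then show "norm (a n i) \<le> norm (b i)"
      by (simp add: a_def b_def norm_mult norm_divide norm_power abs_mult)
  next
    \<comment> \<open>at an imaginary argument all terms of the series are nonnegative\<close>
    have "summable (\<lambda>i. norm (b i * (of_real (R / 2)) ^ (2 * i)))"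
    proof -
      have "summable (\<lambda>i. b i * (\<i> * of_real (R / 2)) ^ (2 * i))"
        unfolding b_def by (rule bessel_coeff_summable[OF \<alpha>])
      moreover have "b i * (\<i> * of_real (R / 2)) ^ (2 * i) = of_real (norm (b i * (of_real (R / 2)) ^ (2 * i)))" for i
      proof -
        have G: "Gamma (real i + \<alpha> + 1) > 0" using \<alpha> by (intro Gamma_real_pos) auto
        have "norm (b i * (of_real (R / 2)) ^ (2 * i)) = (R / 2) ^ (2 * i) / (fact i * Gamma (real i + \<alpha> + 1))"
          using R(1) G by (simp add: b_def norm_mult norm_divide norm_power)
        moreover have "(-1) ^ i * (\<i> * complex_of_real (R / 2)) ^ (2 * i) = of_real ((R / 2) ^ (2 * i))"
        proof -
          have "(-1) ^ i * (\<i> * complex_of_real (R / 2)) ^ (2 * i)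
              = ((-1) * (\<i> * complex_of_real (R / 2))\<^sup>2) ^ i"
            by (simp only: power_mult_distrib[of "-1"] power_mult)
          then show ?thesis by (simp add: power_mult_distrib power_mult power_divide)
        qed
        then have "b i * (\<i> * of_real (R / 2)) ^ (2 * i)
            = of_real ((R / 2) ^ (2 * i) / (fact i * Gamma (real i + \<alpha> + 1)))"
          by (simp add: b_def)
        ultimately show ?thesis by simp
      qed
      ultimately show ?thesis by (simp add: summable_complex_of_real)
    qed
    then show "summable (\<lambda>i. norm (b i) * ((R / 2)\<^sup>2) ^ i)"
      using R(1) by (simp add: norm_mult norm_power power_mult norm_divide)
  next
    fix x assume "x \<in> K"
    then show "norm ((x / 2)\<^sup>2) \<le> (R / 2)\<^sup>2"
      using R(2)[of x] by (simp add: norm_power norm_divide power_mono)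
  qed simp
  moreover have "(\<Sum>i. a n i * ((x / 2)\<^sup>2) ^ i) = laguerre_scaled \<alpha> (m n) n x" for n x
    unfolding laguerre_scaled_def a_def power_mult
    by (rule suminf_finite) auto
  ultimately show ?thesis
    by (simp add: bessel_entire_def[abs_def] b_def power_mult)
qed

lemma continuous_on_bessel_entire:
  assumes "\<alpha> \<ge> - 1 / 2" "compact K"
  shows "continuous_on K (bessel_entire \<alpha>)"
proof -
  have "(\<lambda>n. real n / real n) \<longlonglongrightarrow> 1"
    by (rule tendsto_eventually) (auto intro!: eventually_sequentiallyI[of 1])
  then have "uniform_limit K (\<lambda>n. laguerre_scaled \<alpha> n n) (bessel_entire \<alpha>) sequentially"
    using assms by (intro laguerre_scaled_limit) auto
  moreover have "\<forall>\<^sub>F n in sequentially. continuous_on K (laguerre_scaled \<alpha> n n)"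
    unfolding laguerre_scaled_def[abs_def] by (intro always_eventually allI continuous_intros) auto
  ultimately show ?thesis
    by (intro uniform_limit_theorem[of _ _ sequentially]) auto
qed

lemma poly_map_poly_of_real_smult:
  "poly (map_poly of_real (smult c p)) z = (of_real c * poly (map_poly of_real p) z :: complex)"
  by (simp add: map_poly_smult)

lemma poly_map_poly_of_real_add:
  "poly (map_poly of_real (p + q)) z = (poly (map_poly of_real p) z + poly (map_poly of_real q) z :: complex)"
proof -
  have "map_poly of_real (p + q) = map_poly of_real p + (map_poly of_real q :: complex poly)"
    by (intro poly_eqI) (simp add: coeff_map_poly)
  then show ?thesis by simp
qed

lemma poly_map_poly_of_real_diff:
  "poly (map_poly of_real (p - q)) z = (poly (map_poly of_real p) z - poly (map_poly of_real q) z :: complex)"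
  using poly_map_poly_of_real_add[of "p - q" q z] by simp

lemma poly_map_poly_of_real_sum:
  "poly (map_poly of_real (sum f S)) z = (\<Sum>i\<in>S. poly (map_poly of_real (f i)) z :: complex)"
  by (induction S rule: infinite_finite_induct) (simp_all add: poly_map_poly_of_real_add)

lemma poly_parity_laguerre_scaled:
  assumes "n \<ge> 1"
  shows "poly (map_poly of_real (parity_laguerre e \<alpha> m)) (z / of_real (2 * sqrt (real n)))
    = (z / 2) ^ e / of_real (sqrt (real n)) ^ e * laguerre_scaled \<alpha> m n z"
proof -
  define r :: complex where "r = of_real (sqrt (real n))"
  have r2: "r\<^sup>2 = of_nat n"
    by (simp add: r_def flip: of_real_power)
  then have r2i: "r ^ (i * 2) = of_nat n ^ i" for i by (metis mult.commute power_mult)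
  have r0: "r \<noteq> 0" using assms by (simp add: r_def)
  have "z / of_real (2 * sqrt (real n)) = (z / 2) / r" by (simp add: r_def)
  then show ?thesis
    unfolding parity_laguerre_def poly_map_poly_of_real_sum laguerre_scaled_def sum_distrib_left
    by (intro sum.cong)
      (auto simp: map_poly_monom poly_monom power_divide power_add r2i r0 r_def[symmetric] field_simps)
qed

section \<open>Growth of the kernel diagonals\<close>

text \<open>
Euler's product formula for \<open>\<Gamma>(z)\<close>, read as an asymptotic formula for \<open>\<Gamma>(n + z + 1)\<close>.
\<close>
lemma Gamma_quotient_tendsto:
  assumes "z > 0"
  shows "(\<lambda>n. Gamma (real n + z + 1) / (fact n * real n powr z)) \<longlonglongrightarrow> 1"
proof -
  have "(\<lambda>n. Gamma z / Gamma_series z n) \<longlonglongrightarrow> Gamma z / Gamma z"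
    using Gamma_real_nonzero[OF assms] by (intro tendsto_divide tendsto_const Gamma_series_LIMSEQ)
  moreover have "\<forall>\<^sub>F n in sequentially. Gamma z / Gamma_series z n
      = Gamma (real n + z + 1) / (fact n * real n powr z)"
  proof (rule eventually_sequentiallyI[of 1])
    fix n :: nat assume "n \<ge> 1"
    moreover have "pochhammer z (n + 1) = Gamma (z + real (n + 1)) / Gamma z"
      using assms by (intro pochhammer_Gamma) (auto elim!: nonpos_Ints_cases)
    ultimately show "Gamma z / Gamma_series z n = Gamma (real n + z + 1) / (fact n * real n powr z)"
      using Gamma_real_nonzero[OF assms] by (simp add: Gamma_series_def powr_def add_ac)
  qed
  ultimately show ?thesis
    using Gamma_real_nonzero[OF assms] by (simp add: filterlim_cong)
qed

lemma tendsto_zero_le: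
  fixes f g :: "nat \<Rightarrow> real"
  assumes "\<And>n. n \<ge> 1 \<Longrightarrow> \<bar>f n\<bar> \<le> g n" "g \<longlonglongrightarrow> 0"
  shows "f \<longlonglongrightarrow> 0"
  by (rule Lim_null_comparison[OF _ assms(2)]) (use assms(1) in \<open>auto intro!: eventually_sequentiallyI[of 1]\<close>)

text \<open>
The two kernels that occur in degree \<open>2 n + e\<close> are the one of parity \<open>e\<close> (own) and the one of
parity \<open>1 - e\<close> (other). The degree parameter \<open>n - 1 + e\<close> of the other kernel is the largest for
which it still has degree below \<open>2 n + e\<close>.
\<close>
definition own_diag :: "nat \<Rightarrow> nat \<Rightarrow> real" where
  "own_diag e n = coeff (parity_kernel e (n - 1)) e"

definition other_diag :: "nat \<Rightarrow> nat \<Rightarrow> real" where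
  "other_diag e n = coeff (parity_kernel (1 - e) (n - 1 + e)) (1 - e)"

text \<open>
The factor common to all terms of the rescaled polynomials, see \<open>scaled_eq_laguerre\<close>. The powers
of \<open>n\<close> are those that make it tend to one in both parities.
\<close>
definition gamma_ratio :: "nat \<Rightarrow> nat \<Rightarrow> real" where
  "gamma_ratio e n = Gamma (real n + real e + 1 / 2) / fact n * sqrt (real n) / real n ^ e"

text \<open>
For \<open>e = 1\<close> this is the Gamma asymptotics with exponent \<open>1/2\<close>; the case \<open>e = 0\<close> differs from it by
the factor \<open>n / (n + 1/2)\<close>.
\<close>
lemma gamma_ratio_tendsto:
  assumes "e \<le> 1"
  shows "gamma_ratio e \<longlonglongrightarrow> 1"
proof -
  have "(\<lambda>n. Gamma (real n + 1 / 2 + 1) / (fact n * real n powr (1 / 2))) \<longlonglongrightarrow> 1"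
    by (rule Gamma_quotient_tendsto) simp
  then have g1: "gamma_ratio 1 \<longlonglongrightarrow> 1"
    by (rule Lim_transform_eventually)
      (auto intro!: eventually_sequentiallyI[of 1] simp: gamma_ratio_def powr_half_sqrt add_ac real_div_sqrt
         field_simps)
  have "(\<lambda>n. 1 / 2 / (real n + 1 / 2)) \<longlonglongrightarrow> 0"
    by (rule tendsto_zero_le[OF _ lim_inverse_n]) (simp add: field_simps)
  then have "(\<lambda>n. 1 - 1 / 2 / (real n + 1 / 2)) \<longlonglongrightarrow> 1 - 0"
    by (intro tendsto_diff tendsto_const)
  then have "(\<lambda>n. gamma_ratio 1 n * (1 - 1 / 2 / (real n + 1 / 2))) \<longlonglongrightarrow> 1 * 1"
    by (intro tendsto_mult g1) simp
  moreover have "\<forall>\<^sub>F n in sequentially. gamma_ratio 1 n * (1 - 1 / 2 / (real n + 1 / 2)) = gamma_ratio 0 n"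
  proof (rule eventually_sequentiallyI[of 1])
    fix n :: nat assume "n \<ge> 1"
    have G: "Gamma (real n + real 1 + 1 / 2) = (real n + 1 / 2) * Gamma (real n + 1 / 2)"
      using Gamma_real_plus1[of "real n + 1 / 2"] by (simp add: add_ac)
    have "1 - 1 / 2 / (real n + 1 / 2) = real n / (real n + 1 / 2)" by (simp add: divide_simps)
    then have "gamma_ratio 1 n * (1 - 1 / 2 / (real n + 1 / 2))
        = (real n + 1 / 2) * Gamma (real n + 1 / 2) / fact n * sqrt (real n) / real n
           * (real n / (real n + 1 / 2))"
      by (simp only: gamma_ratio_def G power_one_right)
    also have "\<dots> = Gamma (real n + 1 / 2) / fact n * sqrt (real n)"
      using \<open>n \<ge> 1\<close> by (simp add: add_nonneg_eq_0_iff)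
    finally show "gamma_ratio 1 n * (1 - 1 / 2 / (real n + 1 / 2)) = gamma_ratio 0 n"
      by (simp add: gamma_ratio_def)
  qed
  ultimately have "gamma_ratio 0 \<longlonglongrightarrow> 1"
    by (simp add: filterlim_cong)
  with g1 show ?thesis using assms by (cases "e = 0") (auto simp: le_Suc_eq)
qed

definition diag_const :: "nat \<Rightarrow> real" where
  "diag_const e = 1 / (Gamma (real e + 1 / 2) * Gamma (real e + 3 / 2))"

lemma diag_const_pos: "diag_const e > 0"
  unfolding diag_const_def by (intro divide_pos_pos mult_pos_pos Gamma_real_pos) auto

lemma gamma_ratio_pos: "n \<ge> 1 \<Longrightarrow> gamma_ratio e n > 0"
  unfolding gamma_ratio_def by (intro divide_pos_pos mult_pos_pos Gamma_real_pos) auto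

text \<open>
Together with \<open>other_diag_eq\<close>: the value of the even kernel at the origin grows like \<open>\<surd>n\<close>, and
the derivative of the odd kernel like \<open>n \<surd>n\<close>. This imbalance by a factor \<open>n\<close> is what separates
the singular from the regular nondiagonal mass matrices in even degree.
\<close>
lemma own_diag_eq:
  assumes "n \<ge> 1"
  shows "own_diag e n = diag_const e * gamma_ratio e n * (sqrt (real n) * real n ^ e)"
proof -
  obtain k where n: "n = Suc k" using assms by (cases n) auto
  have "real k + real e + 3 / 2 = real n + real e + 1 / 2" "n - 1 = k" by (simp_all add: n)
  then have "own_diag e n = diag_const e * (Gamma (real n + real e + 1 / 2) / fact k)"
    by (simp only: own_diag_def coeff_parity_kernel_diag diag_const_def) (simp add: mult_ac)
  also have "Gamma (real n + real e + 1 / 2) / fact k = gamma_ratio e n * (sqrt (real n) * real n ^ e)"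
    by (simp add: gamma_ratio_def n)
  finally show ?thesis by simp
qed

lemma other_diag_eq:
  assumes "n \<ge> 1" "e \<le> 1"
  shows "other_diag e n = diag_const (1 - e) * gamma_ratio 1 n * (sqrt (real n) * real n ^ (1 - e))"
proof -
  obtain k where n: "n = Suc k" using assms by (cases n) auto
  consider "e = 0" | "e = 1" using assms(2) by linarith
  then have "other_diag e n = diag_const (1 - e) * (Gamma (real n + 3 / 2) / fact n * real n ^ (1 - e))"
    by cases (simp_all add: other_diag_def coeff_parity_kernel_diag diag_const_def n add_ac)
  also have "Gamma (real n + 3 / 2) / fact n * real n ^ (1 - e)
     = gamma_ratio 1 n * (sqrt (real n) * real n ^ (1 - e))"
  proof -
    define r where "r = sqrt (real n)"
    have r: "r \<noteq> 0" "real n = r * r" using assms(1) by (simp_all add: r_def)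
    have cancel: "r / real n * (r * y) = y" for y unfolding r(2) using r(1) by simp
    have "real n + real 1 + 1 / 2 = real n + 3 / 2" by simp
    then have g: "gamma_ratio 1 n = Gamma (real n + 3 / 2) / fact n * r / real n"
      unfolding gamma_ratio_def r_def power_one_right by (simp only:)
    have "Gamma (real n + 3 / 2) / fact n * y
        = Gamma (real n + 3 / 2) / fact n * (r / real n * (r * y))" for y
      unfolding cancel ..
    also have "\<dots> y = gamma_ratio 1 n * (r * y)" for y
      unfolding g by (simp only: times_divide_eq_left times_divide_eq_right mult.assoc)
    finally show ?thesis unfolding r_def .
  qed
  finally show ?thesis by simp
qed

lemma diag_pos: "own_diag e n > 0" "other_diag e n > 0"
  by (simp_all add: own_diag_def other_diag_def coeff_parity_kernel_diag_pos)

lemma filterlim_sqrt_times_power: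
  "filterlim (\<lambda>n. sqrt (real n) * real n ^ e) at_top sequentially"
proof (rule filterlim_at_top_mono)
  show "filterlim (\<lambda>n. sqrt (real n)) at_top sequentially"
    by (rule filterlim_compose[OF sqrt_at_top filterlim_real_sequentially])
  show "\<forall>\<^sub>F n in sequentially. sqrt (real n) \<le> sqrt (real n) * real n ^ e"
    by (rule eventually_sequentiallyI[of 1]) (simp add: mult_le_cancel_left1)
qed

lemma filterlim_own_diag:
  assumes "e \<le> 1"
  shows "filterlim (own_diag e) at_top sequentially"
proof -
  have "filterlim (\<lambda>n. diag_const e * gamma_ratio e n * (sqrt (real n) * real n ^ e)) at_top sequentially"
    by (rule filterlim_tendsto_pos_mult_at_top[OF tendsto_mult[OF tendsto_const gamma_ratio_tendsto[OF assms]]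
          _ filterlim_sqrt_times_power]) (simp add: diag_const_pos)
  then show ?thesis
    by (rule filterlim_cong[OF refl refl, THEN iffD1, rotated])
      (auto intro!: eventually_sequentiallyI[of 1] simp: own_diag_eq)
qed

lemma filterlim_other_diag:
  assumes "e \<le> 1"
  shows "filterlim (other_diag e) at_top sequentially"
proof -
  have "filterlim (\<lambda>n. diag_const (1 - e) * gamma_ratio 1 n * (sqrt (real n) * real n ^ (1 - e))) at_top sequentially"
    by (rule filterlim_tendsto_pos_mult_at_top[OF tendsto_mult[OF tendsto_const gamma_ratio_tendsto]
          _ filterlim_sqrt_times_power]) (simp_all add: diag_const_pos)
  then show ?thesis
    by (rule filterlim_cong[OF refl refl, THEN iffD1, rotated])
      (use assms in \<open>auto intro!: eventually_sequentiallyI[of 1] simp: other_diag_eq\<close>)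
qed

lemma inverse_sqrt_tendsto_0: "(\<lambda>n. 1 / sqrt (real n)) \<longlonglongrightarrow> 0"
  by (intro tendsto_divide_0[OF tendsto_const] filterlim_at_top_imp_at_infinity
      filterlim_compose[OF sqrt_at_top filterlim_real_sequentially])

lemma own_over_other_diag_even:
  assumes "n \<ge> 1"
  shows "own_diag 0 n / other_diag 0 n
     = diag_const 0 / diag_const 1 * (gamma_ratio 0 n / gamma_ratio 1 n) * inverse (real n)"
proof -
  have "own_diag 0 n = diag_const 0 * gamma_ratio 0 n * sqrt (real n)"
    using own_diag_eq[OF assms, of 0] by simp
  moreover have "other_diag 0 n = diag_const 1 * gamma_ratio 1 n * (sqrt (real n) * real n)"
    using other_diag_eq[OF assms, of 0] by simp
  moreover have "sqrt (real n) \<noteq> 0" using assms by simp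
  ultimately show ?thesis by (simp add: divide_inverse)
qed

lemma own_over_other_diag_even_tendsto: "(\<lambda>n. own_diag 0 n / other_diag 0 n) \<longlonglongrightarrow> 0"
proof -
  have "(\<lambda>n. diag_const 0 / diag_const 1 * (gamma_ratio 0 n / gamma_ratio 1 n) * inverse (real n))
      \<longlonglongrightarrow> diag_const 0 / diag_const 1 * (1 / 1) * 0"
    by (intro tendsto_mult tendsto_divide tendsto_const gamma_ratio_tendsto lim_inverse_n) auto
  then have "(\<lambda>n. diag_const 0 / diag_const 1 * (gamma_ratio 0 n / gamma_ratio 1 n) * inverse (real n))
      \<longlonglongrightarrow> 0" by simp
  then show ?thesis
    by (rule Lim_transform_eventually)
      (intro eventually_sequentiallyI[of 1] own_over_other_diag_even[symmetric])
qed

lemma other_over_own_diag_odd: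
  assumes "n \<ge> 1"
  shows "other_diag 1 n / own_diag 1 n = diag_const 0 / diag_const 1 / real n"
proof -
  have "own_diag 1 n = diag_const 1 * gamma_ratio 1 n * (sqrt (real n) * real n)"
    using own_diag_eq[OF assms, of 1] by simp
  moreover have "other_diag 1 n = diag_const 0 * gamma_ratio 1 n * sqrt (real n)"
    using other_diag_eq[OF assms, of 1] by simp
  moreover have "sqrt (real n) \<noteq> 0" "gamma_ratio 1 n \<noteq> 0"
    using assms gamma_ratio_pos[OF assms, of 1] by simp_all
  ultimately show ?thesis by simp
qed

section \<open>Limits of the correction coefficients\<close>

text \<open>
The coefficient of the kernel of the same parity tends to \<open>1\<close> or to \<open>0\<close>, depending on which term
of \<open>mass_det\<close> dominates. Since \<open>1\<close> minus this coefficient is \<open>(1 + t \<nu>) / mass_det\<close>, the limit is \<open>1\<close>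
exactly when that quotient vanishes in the limit.
\<close>
lemma own_ratio_limit:
  fixes s t :: "nat \<Rightarrow> real"
  assumes pos: "\<mu> \<ge> 0" "\<nu> \<ge> 0" "\<mu> * \<nu> - lam\<^sup>2 \<ge> 0"
    and st: "\<And>n. n \<ge> 1 \<Longrightarrow> s n > 0" "\<And>n. n \<ge> 1 \<Longrightarrow> t n > 0"
    and lim: "(\<lambda>n. (1 + t n * \<nu>) / mass_det \<mu> \<nu> lam (s n) (t n)) \<longlonglongrightarrow> 0"
  shows "(\<lambda>n. s n * (\<mu> + t n * (\<mu> * \<nu> - lam\<^sup>2)) / mass_det \<mu> \<nu> lam (s n) (t n)) \<longlonglongrightarrow> 1"
proof -
  have "(\<lambda>n. 1 - (1 + t n * \<nu>) / mass_det \<mu> \<nu> lam (s n) (t n)) \<longlonglongrightarrow> 1 - 0"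
    by (intro tendsto_diff tendsto_const lim)
  moreover have "\<forall>\<^sub>F n in sequentially. 1 - (1 + t n * \<nu>) / mass_det \<mu> \<nu> lam (s n) (t n)
     = s n * (\<mu> + t n * (\<mu> * \<nu> - lam\<^sup>2)) / mass_det \<mu> \<nu> lam (s n) (t n)"
  proof (rule eventually_sequentiallyI[of 1])
    fix n :: nat assume "n \<ge> 1"
    then have "mass_det \<mu> \<nu> lam (s n) (t n) > 0"
      using st[of n] pos by (intro mass_det_pos) auto
    then show "1 - (1 + t n * \<nu>) / mass_det \<mu> \<nu> lam (s n) (t n)
     = s n * (\<mu> + t n * (\<mu> * \<nu> - lam\<^sup>2)) / mass_det \<mu> \<nu> lam (s n) (t n)"
      by (simp add: field_simps) (simp add: mass_det_def algebra_simps)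
  qed
  ultimately show ?thesis by (simp add: filterlim_cong)
qed

context
  fixes \<mu> \<nu> lam :: real and s t :: "nat \<Rightarrow> real"
  assumes pos: "\<mu> \<ge> 0" "\<nu> \<ge> 0" "\<mu> * \<nu> - lam\<^sup>2 \<ge> 0"
    and st: "\<And>n. n \<ge> 1 \<Longrightarrow> s n > 0" "\<And>n. n \<ge> 1 \<Longrightarrow> t n > 0"
begin

lemma mass_det_bounds:
  assumes "n \<ge> 1"
  shows "1 + s n * \<mu> \<le> mass_det \<mu> \<nu> lam (s n) (t n)" "t n * \<nu> \<le> mass_det \<mu> \<nu> lam (s n) (t n)"
    "s n * t n * (\<mu> * \<nu> - lam\<^sup>2) \<le> mass_det \<mu> \<nu> lam (s n) (t n)"
    "mass_det \<mu> \<nu> lam (s n) (t n) > 0"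
proof -
  have "0 \<le> s n * \<mu>" "0 \<le> t n * \<nu>" "0 \<le> s n * t n * (\<mu> * \<nu> - lam\<^sup>2)"
    using st[OF assms] pos by simp_all
  then show "1 + s n * \<mu> \<le> mass_det \<mu> \<nu> lam (s n) (t n)" "t n * \<nu> \<le> mass_det \<mu> \<nu> lam (s n) (t n)"
    "s n * t n * (\<mu> * \<nu> - lam\<^sup>2) \<le> mass_det \<mu> \<nu> lam (s n) (t n)"
    "mass_det \<mu> \<nu> lam (s n) (t n) > 0"
    by (auto simp: mass_det_def)
qed

text \<open>
The mass of the same parity wins because its kernel grows faster: the odd degrees.
\<close>
lemma own_ratio_tendsto_1_dominant:
  assumes "\<mu> > 0" "filterlim s at_top sequentially" "(\<lambda>n. t n / s n) \<longlonglongrightarrow> 0"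
  shows "(\<lambda>n. s n * (\<mu> + t n * (\<mu> * \<nu> - lam\<^sup>2)) / mass_det \<mu> \<nu> lam (s n) (t n)) \<longlonglongrightarrow> 1"
proof (rule own_ratio_limit[OF pos st])
  have "(\<lambda>n. 1 / (\<mu> * s n) + \<nu> / \<mu> * (t n / s n)) \<longlonglongrightarrow> 0 + \<nu> / \<mu> * 0"
    using assms by (intro tendsto_add tendsto_mult tendsto_const
        tendsto_divide_0[OF tendsto_const] filterlim_at_top_imp_at_infinity
        filterlim_tendsto_pos_mult_at_top[OF tendsto_const]) auto
  then have lim: "(\<lambda>n. 1 / (\<mu> * s n) + \<nu> / \<mu> * (t n / s n)) \<longlonglongrightarrow> 0" by simp
  show "(\<lambda>n. (1 + t n * \<nu>) / mass_det \<mu> \<nu> lam (s n) (t n)) \<longlonglongrightarrow> 0"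
  proof (rule tendsto_zero_le[OF _ lim])
    fix n :: nat assume n: "n \<ge> 1"
    have "(1 + t n * \<nu>) / mass_det \<mu> \<nu> lam (s n) (t n) \<le> (1 + t n * \<nu>) / (s n * \<mu>)"
      using mass_det_bounds(1)[OF n] st[OF n] pos assms(1)
      by (intro divide_left_mono) (auto intro!: mult_pos_pos mass_det_bounds n)
    also have "\<dots> = 1 / (\<mu> * s n) + \<nu> / \<mu> * (t n / s n)"
      using st[OF n] assms(1) by (simp add: field_simps)
    finally show "\<bar>(1 + t n * \<nu>) / mass_det \<mu> \<nu> lam (s n) (t n)\<bar> \<le> 1 / (\<mu> * s n) + \<nu> / \<mu> * (t n / s n)"
      using mass_det_bounds(4)[OF n] st[OF n] pos by simp
  qed
qed

text \<open>
For a regular mass matrix the term \<open>s t det A\<close> dominates all others.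
\<close>
lemma own_ratio_tendsto_1_definite:
  assumes "\<mu> * \<nu> - lam\<^sup>2 > 0" "filterlim s at_top sequentially" "filterlim t at_top sequentially"
  shows "(\<lambda>n. s n * (\<mu> + t n * (\<mu> * \<nu> - lam\<^sup>2)) / mass_det \<mu> \<nu> lam (s n) (t n)) \<longlonglongrightarrow> 1"
proof (rule own_ratio_limit[OF pos st])
  let ?\<Delta> = "\<mu> * \<nu> - lam\<^sup>2"
  have inv: "(\<lambda>n. inverse (s n)) \<longlonglongrightarrow> 0" "(\<lambda>n. inverse (t n)) \<longlonglongrightarrow> 0"
    using assms by (auto intro!: tendsto_inverse_0_at_top)
  have "(\<lambda>n. inverse (s n) * (inverse (t n) + \<nu>) / ?\<Delta>) \<longlonglongrightarrow> 0 * (0 + \<nu>) / ?\<Delta>"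
    using assms(1) by (intro tendsto_divide tendsto_mult tendsto_add tendsto_const inv) auto
  then have lim: "(\<lambda>n. inverse (s n) * (inverse (t n) + \<nu>) / ?\<Delta>) \<longlonglongrightarrow> 0" by simp
  show "(\<lambda>n. (1 + t n * \<nu>) / mass_det \<mu> \<nu> lam (s n) (t n)) \<longlonglongrightarrow> 0"
  proof (rule tendsto_zero_le[OF _ lim])
    fix n :: nat assume n: "n \<ge> 1"
    have "(1 + t n * \<nu>) / mass_det \<mu> \<nu> lam (s n) (t n) \<le> (1 + t n * \<nu>) / (s n * t n * ?\<Delta>)"
      using mass_det_bounds(3)[OF n] st[OF n] pos assms(1)
      by (intro divide_left_mono) (auto intro!: mult_pos_pos mass_det_bounds n)
    also have "\<dots> = inverse (s n) * (inverse (t n) + \<nu>) / ?\<Delta>"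
      using st[OF n] assms(1) by (simp add: divide_simps)
    finally show "\<bar>(1 + t n * \<nu>) / mass_det \<mu> \<nu> lam (s n) (t n)\<bar> \<le> inverse (s n) * (inverse (t n) + \<nu>) / ?\<Delta>"
      using mass_det_bounds(4)[OF n] st[OF n] pos by simp
  qed
qed

lemma own_ratio_tendsto_1_only:
  assumes "\<mu> > 0" "\<nu> = 0" "filterlim s at_top sequentially"
  shows "(\<lambda>n. s n * (\<mu> + t n * (\<mu> * \<nu> - lam\<^sup>2)) / mass_det \<mu> \<nu> lam (s n) (t n)) \<longlonglongrightarrow> 1"
proof (rule own_ratio_limit[OF pos st])
  have inv: "(\<lambda>n. inverse (s n)) \<longlonglongrightarrow> 0"
    using assms by (auto intro!: tendsto_inverse_0_at_top)
  have "(\<lambda>n. inverse (s n) / \<mu>) \<longlonglongrightarrow> 0 / \<mu>"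
    using assms(1) by (intro tendsto_divide tendsto_const inv) auto
  then have lim: "(\<lambda>n. inverse (s n) / \<mu>) \<longlonglongrightarrow> 0" by simp
  show "(\<lambda>n. (1 + t n * \<nu>) / mass_det \<mu> \<nu> lam (s n) (t n)) \<longlonglongrightarrow> 0"
  proof (rule tendsto_zero_le[OF _ lim])
    fix n :: nat assume n: "n \<ge> 1"
    have "1 / mass_det \<mu> \<nu> lam (s n) (t n) \<le> 1 / (s n * \<mu>)"
      using mass_det_bounds(1)[OF n] st[OF n] pos assms(1)
      by (intro divide_left_mono) (auto intro!: mult_pos_pos mass_det_bounds n)
    then show "\<bar>(1 + t n * \<nu>) / mass_det \<mu> \<nu> lam (s n) (t n)\<bar> \<le> inverse (s n) / \<mu>"
      using mass_det_bounds(4)[OF n] assms(2) by (simp add: divide_simps)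
  qed
qed

text \<open>
For a singular mass matrix the term \<open>s t det A\<close> is absent, and the mass of the opposite parity
wins if its kernel grows faster. This happens in even degree for singular nondiagonal matrices and is
the reason why they behave as if there were no mass at the origin.
\<close>
lemma own_ratio_tendsto_0:
  assumes "\<mu> * \<nu> - lam\<^sup>2 = 0" "\<nu> > 0" "(\<lambda>n. s n / t n) \<longlonglongrightarrow> 0"
  shows "(\<lambda>n. s n * (\<mu> + t n * (\<mu> * \<nu> - lam\<^sup>2)) / mass_det \<mu> \<nu> lam (s n) (t n)) \<longlonglongrightarrow> 0"
proof (rule tendsto_zero_le)
  have "(\<lambda>n. \<mu> / \<nu> * (s n / t n)) \<longlonglongrightarrow> \<mu> / \<nu> * 0" by (intro tendsto_mult tendsto_const assms)
  then show "(\<lambda>n. \<mu> / \<nu> * (s n / t n)) \<longlonglongrightarrow> 0" by simp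
  fix n :: nat assume n: "n \<ge> 1"
  have "s n * \<mu> / mass_det \<mu> \<nu> lam (s n) (t n) \<le> s n * \<mu> / (t n * \<nu>)"
    using mass_det_bounds(2)[OF n] st[OF n] pos assms(2)
    by (intro divide_left_mono) (auto intro!: mult_pos_pos mass_det_bounds n)
  then show "\<bar>s n * (\<mu> + t n * (\<mu> * \<nu> - lam\<^sup>2)) / mass_det \<mu> \<nu> lam (s n) (t n)\<bar> \<le> \<mu> / \<nu> * (s n / t n)"
    unfolding assms(1) using mass_det_bounds(4)[OF n] st[OF n] pos by (simp add: mult_ac)
qed

text \<open>
The kernel of opposite parity enters with the coefficient \<open>lam t / mass_det\<close> and a factor \<open>d\<close> from
the rescaling. The first alternative is used in odd and the second in even degree.
\<close>
lemma cross_term_tendsto_0: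
  assumes d: "\<And>n. n \<ge> 1 \<Longrightarrow> d n \<ge> (0::real)"
    and bound: "\<mu> > 0 \<and> (\<lambda>n. t n / s n * d n) \<longlonglongrightarrow> 0 \<or> \<nu> > 0 \<and> d \<longlonglongrightarrow> 0 \<or> lam = 0"
  shows "(\<lambda>n. lam * t n / mass_det \<mu> \<nu> lam (s n) (t n) * d n) \<longlonglongrightarrow> 0"
  using bound
proof (elim disjE conjE)
  assume \<mu>: "\<mu> > 0" and l: "(\<lambda>n. t n / s n * d n) \<longlonglongrightarrow> 0"
  have "(\<lambda>n. \<bar>lam\<bar> / \<mu> * (t n / s n * d n)) \<longlonglongrightarrow> \<bar>lam\<bar> / \<mu> * 0"
    by (intro tendsto_mult tendsto_const l)
  then have l0: "(\<lambda>n. \<bar>lam\<bar> / \<mu> * (t n / s n * d n)) \<longlonglongrightarrow> 0" by simp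
  show ?thesis
  proof (rule tendsto_zero_le[OF _ l0])
    fix n :: nat assume n: "n \<ge> 1"
    have "\<bar>lam\<bar> * t n * d n / mass_det \<mu> \<nu> lam (s n) (t n) \<le> \<bar>lam\<bar> * t n * d n / (s n * \<mu>)"
      using mass_det_bounds(1)[OF n] st[OF n] d[OF n] \<mu>
      by (intro divide_left_mono) (auto intro!: mult_pos_pos mass_det_bounds n)
    then show "\<bar>lam * t n / mass_det \<mu> \<nu> lam (s n) (t n) * d n\<bar> \<le> \<bar>lam\<bar> / \<mu> * (t n / s n * d n)"
      using mass_det_bounds(4)[OF n] st[OF n] d[OF n] by (simp add: abs_mult mult_ac)
  qed
next
  assume \<nu>: "\<nu> > 0" and l: "d \<longlonglongrightarrow> 0"
  have "(\<lambda>n. \<bar>lam\<bar> / \<nu> * d n) \<longlonglongrightarrow> \<bar>lam\<bar> / \<nu> * 0"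
    by (intro tendsto_mult tendsto_const l)
  then have l0: "(\<lambda>n. \<bar>lam\<bar> / \<nu> * d n) \<longlonglongrightarrow> 0" by simp
  show ?thesis
  proof (rule tendsto_zero_le[OF _ l0])
    fix n :: nat assume n: "n \<ge> 1"
    have "\<bar>lam\<bar> * t n * d n / mass_det \<mu> \<nu> lam (s n) (t n) \<le> \<bar>lam\<bar> * t n * d n / (t n * \<nu>)"
      using mass_det_bounds(2)[OF n] st[OF n] d[OF n] \<nu>
      by (intro divide_left_mono) (auto intro!: mult_pos_pos mass_det_bounds n)
    then show "\<bar>lam * t n / mass_det \<mu> \<nu> lam (s n) (t n) * d n\<bar> \<le> \<bar>lam\<bar> / \<nu> * d n"
      using mass_det_bounds(4)[OF n] st[OF n] d[OF n] by (simp add: abs_mult mult_ac)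
  qed
qed simp

end

section \<open>Assembly of the limits\<close>

lemma uniform_limit_mult_compact:
  fixes f g :: "nat \<Rightarrow> complex \<Rightarrow> complex"
  assumes "compact K" "continuous_on K F" "continuous_on K G"
    and "uniform_limit K f F sequentially" "uniform_limit K g G sequentially"
  shows "uniform_limit K (\<lambda>n x. f n x * g n x) (\<lambda>x. F x * G x) sequentially"
  using assms by (intro uniform_lim_mult compact_imp_bounded compact_continuous_image)

lemma uniform_limit_of_real_sequence:
  "r \<longlonglongrightarrow> l \<Longrightarrow>
   uniform_limit K (\<lambda>n x. complex_of_real (r n)) (\<lambda>x. of_real l) sequentially"
proof (rule uniform_limitI)
  fix \<epsilon> :: real assume "r \<longlonglongrightarrow> l" "\<epsilon> > 0"
  then have "\<forall>\<^sub>F n in sequentially. dist (r n) l < \<epsilon>" by (rule tendstoD)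
  then show "\<forall>\<^sub>F n in sequentially. \<forall>x\<in>K. dist (complex_of_real (r n)) (of_real l) < \<epsilon>"
    by eventually_elim simp
qed

definition own_ratio :: "nat \<Rightarrow> real \<Rightarrow> real \<Rightarrow> real \<Rightarrow> nat \<Rightarrow> real" where
  "own_ratio e \<mu> \<nu> lam n = own_diag e n * (\<mu> + other_diag e n * (\<mu> * \<nu> - lam\<^sup>2))
     / mass_det \<mu> \<nu> lam (own_diag e n) (other_diag e n)"

text \<open>
The factor \<open>n^e / \<surd>n\<close> is the quotient of the powers \<open>(\<surd>n)^e\<close> and \<open>(\<surd>n)^(1 - e)\<close> that the
rescaling extracts from the two kernels.
\<close>
definition cross_ratio :: "nat \<Rightarrow> real \<Rightarrow> real \<Rightarrow> real \<Rightarrow> nat \<Rightarrow> real" where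
  "cross_ratio e \<mu> \<nu> lam n = lam * other_diag e n
     / mass_det \<mu> \<nu> lam (own_diag e n) (other_diag e n) * (real n ^ e / sqrt (real n))"

text \<open>
The normalisation of the theorem for both parities at once: the prefactor is \<open>\<surd>n\<close> for \<open>e = 0\<close> and
\<open>1\<close> for \<open>e = 1\<close>, the latter for \<open>n \<ge> 1\<close> only since \<open>0 / 0 = 0\<close>.
\<close>
definition scaled :: "nat \<Rightarrow> (nat \<Rightarrow> real poly) \<Rightarrow> nat \<Rightarrow> complex \<Rightarrow> complex" where
  "scaled e Q n x = of_real ((-1) ^ n * (sqrt (real n) / sqrt (real n) ^ e) / fact n)
     * poly (map_poly of_real (Q (2 * n + e))) (x / of_real (2 * sqrt (real n)))"

definition sobolev_orthogonal :: "nat \<Rightarrow> real \<Rightarrow> real \<Rightarrow> real \<Rightarrow> (nat \<Rightarrow> real poly) \<Rightarrow> bool" where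
  "sobolev_orthogonal e \<mu> \<nu> lam Q \<longleftrightarrow>
     (\<forall>n. degree (Q n) = n \<and> lead_coeff (Q n) = 1 \<and> (\<forall>p. degree p < n \<longrightarrow>
        gauss_int (Q n * p) + (\<mu> * coeff (Q n) e + lam * coeff (Q n) (1 - e)) * coeff p e
          + (lam * coeff (Q n) e + \<nu> * coeff (Q n) (1 - e)) * coeff p (1 - e) = 0))"

context
  fixes e :: nat and \<mu> \<nu> lam :: real and Q :: "nat \<Rightarrow> real poly"
  assumes e: "e \<le> 1"
    and pos: "\<mu> \<ge> 0" "\<nu> \<ge> 0" "\<mu> * \<nu> - lam\<^sup>2 \<ge> 0"
    and Q: "sobolev_orthogonal e \<mu> \<nu> lam Q"
begin

lemma scaled_eq_laguerre:
  assumes n: "n \<ge> 1"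
  shows "scaled e Q n x = of_real (gamma_ratio e n) *
     ((x / 2) ^ e * (laguerre_scaled (real e - 1 / 2) n n x
         - of_real (own_ratio e \<mu> \<nu> lam n) * (of_real (real e + 1 / 2) * laguerre_scaled (real e + 1 / 2) (n - 1) n x))
      - of_real (cross_ratio e \<mu> \<nu> lam n) * (of_real (Gamma (real (1 - e) + 3 / 2) / Gamma (real e + 1 / 2))
         * (x / 2) ^ (1 - e) * laguerre_scaled (real (1 - e) + 1 / 2) (n - 1 + e) n x))"
proof -
  define q where "q = lam * other_diag e n / mass_det \<mu> \<nu> lam (own_diag e n) (other_diag e n)"
  define C where "C = Gamma (real (1 - e) + 3 / 2) / Gamma (real e + 1 / 2)"
  define c where "c = (-1) ^ n * Gamma (real n + real e + 1 / 2)"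
  have *: "degree (Q (2 * n + e)) \<le> 2 * n + e" "coeff (Q (2 * n + e)) (2 * n + e) = 1"
    using Q unfolding sobolev_orthogonal_def by (auto dest: spec[of _ "2 * n + e"])
  have orth: "gauss_int (Q (2 * n + e) * p)
        + (\<mu> * coeff (Q (2 * n + e)) e + lam * coeff (Q (2 * n + e)) (1 - e)) * coeff p e
          + (lam * coeff (Q (2 * n + e)) e + \<nu> * coeff (Q (2 * n + e)) (1 - e)) * coeff p (1 - e) = 0"
    if "degree p < 2 * n + e" for p
    using Q that unfolding sobolev_orthogonal_def by blast
  have QQ: "Q (2 * n + e) = smult c
     (parity_laguerre e (real e - 1 / 2) n
      - smult (own_ratio e \<mu> \<nu> lam n * (real e + 1 / 2)) (parity_laguerre e (real e + 1 / 2) (n - 1))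
      - smult (q * C) (parity_laguerre (1 - e) (real (1 - e) + 1 / 2) (n - 1 + e)))"
    using sobolev_polynomial_expansion[OF e n pos * orth]
    unfolding own_diag_def[symmetric] other_diag_def[symmetric] own_ratio_def[symmetric]
      q_def[symmetric] c_def[symmetric] C_def by simp
  define R where "R = sqrt (real n)"
  have R: "R > 0" "R * R = real n" using n by (simp_all add: R_def)
  define P where "P = (-1) ^ n * (R / R ^ e) / fact n * c / R ^ e"
  have sign: "(-1) ^ n * c = Gamma (real n + real e + 1 / 2)"
    by (simp add: c_def mult.assoc[symmetric] power_mult_distrib[symmetric])
  have square: "R ^ e * R ^ e = real n ^ e" using R(2) by (metis power_mult_distrib)
  have "P = ((-1) ^ n * c) / fact n * R / (R ^ e * R ^ e)" by (simp add: P_def mult_ac)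
  then have P: "P = gamma_ratio e n" 
    unfolding sign square gamma_ratio_def R_def[symmetric] .
  have cr: "cross_ratio e \<mu> \<nu> lam n = q * (R ^ e / R ^ (1 - e))"
  proof -
    have "e = 0 \<or> e = 1" using e by auto
    then have "real n ^ e / R = R ^ e / R ^ (1 - e)"
      using R(1) unfolding R(2)[symmetric] by auto
    then show ?thesis unfolding cross_ratio_def q_def R_def by (simp only:)
  qed
  have "scaled e Q n x = of_real ((-1) ^ n * (R / R ^ e) / fact n * c) *
     ((x / 2) ^ e / of_real R ^ e * laguerre_scaled (real e - 1 / 2) n n x
      - of_real (own_ratio e \<mu> \<nu> lam n * (real e + 1 / 2))
          * ((x / 2) ^ e / of_real R ^ e * laguerre_scaled (real e + 1 / 2) (n - 1) n x)
      - of_real (q * C) * ((x / 2) ^ (1 - e) / of_real R ^ (1 - e)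
          * laguerre_scaled (real (1 - e) + 1 / 2) (n - 1 + e) n x))"
    unfolding scaled_def QQ poly_map_poly_of_real_smult poly_map_poly_of_real_diff
      poly_parity_laguerre_scaled[OF n] R_def by (simp only: of_real_mult mult.assoc)
  also have "\<dots> = of_real P *
     ((x / 2) ^ e * (laguerre_scaled (real e - 1 / 2) n n x
         - of_real (own_ratio e \<mu> \<nu> lam n) * (of_real (real e + 1 / 2) * laguerre_scaled (real e + 1 / 2) (n - 1) n x))
      - of_real (cross_ratio e \<mu> \<nu> lam n) * (of_real C
         * (x / 2) ^ (1 - e) * laguerre_scaled (real (1 - e) + 1 / 2) (n - 1 + e) n x))"
  proof -
    have factor: "w * (X / S * F - a * h * (X / S * G) - b * d * (Y / T * E))
        = w / S * (X * (F - a * (h * G)) - b * (S / T) * (d * Y * E))"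
      if "S \<noteq> 0" for w X S F a h G b d Y T E :: complex
    proof -
      have "w / S * (b * (S / T) * (d * Y * E)) = w * (b * d * (Y / T * E))" using that by simp
      moreover have "w / S * (X * (F - a * (h * G))) = w * (X / S * F - a * h * (X / S * G))"
        by (simp add: divide_inverse right_diff_distrib mult_ac)
      ultimately show ?thesis
        unfolding right_diff_distrib[of "w / S" "X * (F - a * (h * G))"]
          right_diff_distrib[of w "X / S * F - a * h * (X / S * G)"] by (simp only:)
    qed
    have "complex_of_real R ^ e \<noteq> 0" using R(1) by simp
    then show ?thesis
      unfolding P_def cr of_real_mult of_real_divide of_real_power by (rule factor)
  qed
  finally show ?thesis unfolding P C_def .
qed

text \<open>
Once the correction of opposite parity disappears, only the limit \<open>\<rho>\<close> of the coefficient of the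
kernel of the same parity is visible. The cases \<open>\<rho> = 0\<close> and \<open>\<rho> = 1\<close> below are the only ones that
occur.
\<close>
lemma uniform_limit_scaled:
  assumes own: "own_ratio e \<mu> \<nu> lam \<longlonglongrightarrow> \<rho>" and cross: "cross_ratio e \<mu> \<nu> lam \<longlonglongrightarrow> 0"
    and K: "compact K"
  shows "uniform_limit K (scaled e Q)
     (\<lambda>x. (x / 2) ^ e * (bessel_entire (real e - 1 / 2) x
        - of_real \<rho> * (of_real (real e + 1 / 2) * bessel_entire (real e + 1 / 2) x))) sequentially"
proof -
  define C where "C = Gamma (real (1 - e) + 3 / 2) / Gamma (real e + 1 / 2)"
  \<comment> \<open>agrees with \<open>n - 1 + e\<close> for \<open>n \<ge> 1\<close>; the value at \<open>0\<close> makes \<open>m n \<le> n\<close> hold for every \<open>n\<close>\<close>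
  define m where "m n = n - 1 + (if n = 0 then 0 else e)" for n
  have r1: "(\<lambda>n. real n / real n) \<longlonglongrightarrow> 1"
    by (rule tendsto_eventually) (auto intro!: eventually_sequentiallyI[of 1])
  have r2: "(\<lambda>n. real (n - 1) / real n) \<longlonglongrightarrow> 1"
  proof -
    have "(\<lambda>n. 1 - inverse (real n)) \<longlonglongrightarrow> 1 - 0"
      by (intro tendsto_diff tendsto_const lim_inverse_n)
    moreover have "\<forall>\<^sub>F n in sequentially. 1 - inverse (real n) = real (n - 1) / real n"
      by (rule eventually_sequentiallyI[of 1]) (simp add: field_simps of_nat_diff)
    ultimately show ?thesis by (simp add: filterlim_cong)
  qed
  have r3: "(\<lambda>n. real (m n) / real n) \<longlonglongrightarrow> 1"
  proof (cases "e = 0")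
    case False
    then have "m n = n" for n using e by (auto simp: m_def)
    then show ?thesis using r1 by simp
  qed (use r2 in \<open>simp add: m_def cong: if_cong\<close>)
  have m_le: "m n \<le> n" for n using e by (auto simp: m_def)
  note cont = continuous_on_bessel_entire[OF _ K] continuous_intros
  note L1 = laguerre_scaled_limit[OF _ order_refl r1 K]
  note L2 = laguerre_scaled_limit[OF _ diff_le_self r2 K]
  note L3 = laguerre_scaled_limit[OF _ m_le r3 K]
  have "uniform_limit K
    (\<lambda>n x. of_real (gamma_ratio e n) *
     ((x / 2) ^ e * (laguerre_scaled (real e - 1 / 2) n n x
         - of_real (own_ratio e \<mu> \<nu> lam n) * (of_real (real e + 1 / 2) * laguerre_scaled (real e + 1 / 2) (n - 1) n x))
      - of_real (cross_ratio e \<mu> \<nu> lam n) * (of_real C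
         * (x / 2) ^ (1 - e) * laguerre_scaled (real (1 - e) + 1 / 2) (m n) n x)))
    (\<lambda>x. of_real 1 *
     ((x / 2) ^ e * (bessel_entire (real e - 1 / 2) x
         - of_real \<rho> * (of_real (real e + 1 / 2) * bessel_entire (real e + 1 / 2) x))
      - of_real 0 * (of_real C
         * (x / 2) ^ (1 - e) * bessel_entire (real (1 - e) + 1 / 2) x))) sequentially"
    by (intro uniform_limit_mult_compact[OF K] uniform_limit_minus uniform_limit_of_real_sequence
        L1 L2 L3 own cross gamma_ratio_tendsto[OF e] uniform_limit_const cont) auto
  moreover have "\<forall>\<^sub>F n in sequentially. \<forall>x\<in>K. of_real (gamma_ratio e n) *
     ((x / 2) ^ e * (laguerre_scaled (real e - 1 / 2) n n x
         - of_real (own_ratio e \<mu> \<nu> lam n) * (of_real (real e + 1 / 2) * laguerre_scaled (real e + 1 / 2) (n - 1) n x))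
      - of_real (cross_ratio e \<mu> \<nu> lam n) * (of_real C
         * (x / 2) ^ (1 - e) * laguerre_scaled (real (1 - e) + 1 / 2) (m n) n x)) = scaled e Q n x"
    by (rule eventually_sequentiallyI[of 1]) (simp add: scaled_eq_laguerre m_def C_def)
  ultimately show ?thesis
    by (subst (asm) uniform_limit_cong[where g = "scaled e Q"]) auto
qed

lemma scaled_limit_free:
  assumes "own_ratio e \<mu> \<nu> lam \<longlonglongrightarrow> 0" and "cross_ratio e \<mu> \<nu> lam \<longlonglongrightarrow> 0"
  shows "compactly_uniform_limit (scaled e Q) (sqrt_bessel_J (real e - 1 / 2))"
  unfolding compactly_uniform_limit_def
proof (intro allI impI)
  fix K :: "complex set" assume "compact K"
  have "sqrt_bessel_J (real e - 1 / 2) = (\<lambda>x. (x / 2) ^ e * bessel_entire (real e - 1 / 2) x)"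
    by (intro ext sqrt_bessel_J_eq_bessel_entire refl)
  then show "uniform_limit K (scaled e Q) (sqrt_bessel_J (real e - 1 / 2)) sequentially"
    using uniform_limit_scaled[OF assms \<open>compact K\<close>]
    by (simp only: of_real_0 mult_zero_left diff_zero)
qed

lemma scaled_limit_constrained:
  assumes "own_ratio e \<mu> \<nu> lam \<longlonglongrightarrow> 1" and "cross_ratio e \<mu> \<nu> lam \<longlonglongrightarrow> 0"
  shows "compactly_uniform_limit (scaled e Q) (\<lambda>x. - sqrt_bessel_J (real e + 3 / 2) x)"
  unfolding compactly_uniform_limit_def
proof (intro allI impI)
  fix K :: "complex set" assume "compact K"
  note lim = uniform_limit_scaled[OF assms this]
  have "(x / 2) ^ e * (bessel_entire (real e - 1 / 2) x
        - of_real 1 * (of_real (real e + 1 / 2) * bessel_entire (real e + 1 / 2) x))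
      = - sqrt_bessel_J (real e + 3 / 2) x" for x
  proof -
    have "bessel_entire (real e - 1 / 2) x - of_real (real e + 1 / 2) * bessel_entire (real e + 1 / 2) x
        = - ((x / 2)\<^sup>2 * bessel_entire (real e + 3 / 2) x)"
      using bessel_entire_contiguous[of "real e - 1 / 2" x] by (simp add: add_ac)
    moreover have "sqrt_bessel_J (real e + 3 / 2) x = (x / 2) ^ (e + 2) * bessel_entire (real e + 3 / 2) x"
      by (rule sqrt_bessel_J_eq_bessel_entire) simp
    ultimately show ?thesis
      by (simp only: of_real_1 mult_1_left mult_minus_right power_add mult.assoc)
  qed
  then show "uniform_limit K (scaled e Q) (\<lambda>x. - sqrt_bessel_J (real e + 3 / 2) x) sequentially"
    using lim by (simp only:)
qed

end

lemma scaled_even_eq: "scaled_even Q = scaled 0 Q"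
  by (simp add: fun_eq_iff scaled_even_def scaled_def)

lemma scaled_odd_eq: "n \<ge> 1 \<Longrightarrow> scaled 1 Q n x = scaled_odd Q n x"
  by (simp add: scaled_odd_def scaled_def)

lemma compactly_uniform_limit_scaled_odd:
  assumes "compactly_uniform_limit (scaled 1 Q) g"
  shows "compactly_uniform_limit (scaled_odd Q) g"
proof -
  have "uniform_limit K (scaled_odd Q) g sequentially \<longleftrightarrow> uniform_limit K (scaled 1 Q) g sequentially" for K
    by (intro uniform_limit_cong eventually_sequentiallyI[of 1]) (auto simp: scaled_odd_eq[unfolded One_nat_def])
  then show ?thesis using assms by (simp add: compactly_uniform_limit_def)
qed

theorem theorem1:
  fixes M0 M1 lam :: real
    and A :: "real ^ 2 ^ 2"
    and Q :: "nat \<Rightarrow> real poly"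
  assumes "M0 \<ge> 0" and "M1 \<ge> 0" and "M0 * M1 - lam\<^sup>2 \<ge> 0"
    and "A = vector [vector [M0, lam], vector [lam, M1]]"
    and "A \<noteq> 0"
    and "monic_orthogonal_seq (sobolev_inner A) Q"
  shows
    "(lam = 0 \<longrightarrow>
        (rank A = 1 \<and> M0 = 0 \<longrightarrow>
           compactly_uniform_limit (scaled_even Q) (\<lambda>x. sqrt_bessel_J (- 1 / 2) x)) \<and>
        (rank A = 1 \<and> M0 > 0 \<longrightarrow>
           compactly_uniform_limit (scaled_even Q) (\<lambda>x. - sqrt_bessel_J (3 / 2) x)) \<and>
        (rank A = 2 \<longrightarrow>
           compactly_uniform_limit (scaled_even Q) (\<lambda>x. - sqrt_bessel_J (3 / 2) x)))
   \<and> (lam \<noteq> 0 \<longrightarrow>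
        (rank A = 1 \<longrightarrow>
           compactly_uniform_limit (scaled_even Q) (\<lambda>x. sqrt_bessel_J (- 1 / 2) x)) \<and>
        (rank A = 2 \<longrightarrow>
           compactly_uniform_limit (scaled_even Q) (\<lambda>x. - sqrt_bessel_J (3 / 2) x)))
   \<and> (lam = 0 \<longrightarrow>
        (rank A = 1 \<and> M1 = 0 \<longrightarrow>
           compactly_uniform_limit (scaled_odd Q) (\<lambda>x. sqrt_bessel_J (1 / 2) x)) \<and>
        (rank A = 1 \<and> M1 > 0 \<longrightarrow>
           compactly_uniform_limit (scaled_odd Q) (\<lambda>x. - sqrt_bessel_J (5 / 2) x)) \<and>
        (rank A = 2 \<longrightarrow>
           compactly_uniform_limit (scaled_odd Q) (\<lambda>x. - sqrt_bessel_J (5 / 2) x)))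
   \<and> (lam \<noteq> 0 \<longrightarrow>
        (rank A = 1 \<longrightarrow>
           compactly_uniform_limit (scaled_odd Q) (\<lambda>x. - sqrt_bessel_J (5 / 2) x)) \<and>
        (rank A = 2 \<longrightarrow>
           compactly_uniform_limit (scaled_odd Q) (\<lambda>x. - sqrt_bessel_J (5 / 2) x)))"
proof -
  note pos0 = assms(1-3)
  have pos1: "M1 \<ge> 0" "M0 \<ge> 0" "M1 * M0 - lam\<^sup>2 \<ge> 0" using pos0 by (simp_all add: mult.commute)
  have Q: "degree (Q n) = n" "lead_coeff (Q n) = 1"
      "degree p < n \<Longrightarrow> sobolev_inner A (Q n) p = 0" for n p
    using assms(6) unfolding monic_orthogonal_seq_def by blast+
  have Q0: "sobolev_orthogonal 0 M0 M1 lam Q" and Q1: "sobolev_orthogonal 1 M1 M0 lam Q"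
    using Q by (auto simp: sobolev_orthogonal_def sobolev_inner_eq[OF assms(4)] algebra_simps)
  note even = pos0 Q0 and odd = pos1 Q1
  have lam_pos: "M0 > 0" "M1 > 0" if "lam \<noteq> 0"
  proof -
    have "lam\<^sup>2 > 0" using that by simp
    then have "M0 * M1 > 0" using pos0(3) by linarith
    then show "M0 > 0" "M1 > 0" using pos0 by (auto simp: zero_less_mult_iff)
  qed
  \<comment> \<open>the rank only matters through the vanishing of the determinant\<close>
  have det: "det A = M0 * M1 - lam\<^sup>2"
    by (simp add: assms(4) det_2 power2_eq_square)
  have rank1: "M0 * M1 - lam\<^sup>2 = 0" if "rank A = 1"
    using det_eq_0_rank[of A] that det by simp
  have rank2: "M0 * M1 - lam\<^sup>2 > 0" if "rank A = 2"
    using det_eq_0_rank[of A] that det pos0(3) by simp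
  \<comment> \<open>the corrections of opposite parity vanish: by the factor \<open>1 / \<surd>n\<close> in even degree, and in odd
    degree because the quotient of the diagonals is of order \<open>1 / n\<close> against a factor \<open>\<surd>n\<close>\<close>
  have cross0: "cross_ratio 0 M0 M1 lam \<longlonglongrightarrow> 0"
    unfolding cross_ratio_def[abs_def]
    by (rule cross_term_tendsto_0[OF pos0 diag_pos])
      (use lam_pos inverse_sqrt_tendsto_0 in auto)
  have cross1: "cross_ratio 1 M1 M0 lam \<longlonglongrightarrow> 0"
    unfolding cross_ratio_def[abs_def]
  proof (rule cross_term_tendsto_0[OF pos1 diag_pos])
    have "(\<lambda>n. diag_const 0 / diag_const 1 * (1 / sqrt (real n))) \<longlonglongrightarrow> diag_const 0 / diag_const 1 * 0"
      by (intro tendsto_mult tendsto_const inverse_sqrt_tendsto_0)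
    then have "(\<lambda>n. diag_const 0 / diag_const 1 * (1 / sqrt (real n))) \<longlonglongrightarrow> 0" by simp
    moreover have "\<forall>\<^sub>F n in sequentially. diag_const 0 / diag_const 1 * (1 / sqrt (real n))
        = other_diag 1 n / own_diag 1 n * (real n ^ 1 / sqrt (real n))"
      by (rule eventually_sequentiallyI[of 1])
        (simp only: other_over_own_diag_odd power_one_right, simp)
    ultimately have "(\<lambda>n. other_diag 1 n / own_diag 1 n * (real n ^ 1 / sqrt (real n))) \<longlonglongrightarrow> 0"
      by (rule Lim_transform_eventually)
    then show "M1 > 0 \<and> (\<lambda>n. other_diag 1 n / own_diag 1 n * (real n ^ 1 / sqrt (real n))) \<longlonglongrightarrow> 0
      \<or> M0 > 0 \<and> (\<lambda>n. real n ^ 1 / sqrt (real n)) \<longlonglongrightarrow> 0 \<or> lam = 0"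
      using lam_pos by auto
  qed simp
  have s0: "filterlim (own_diag 0) at_top sequentially" and t0: "filterlim (other_diag 0) at_top sequentially"
    and s1: "filterlim (own_diag 1) at_top sequentially"
    by (simp_all add: filterlim_own_diag filterlim_other_diag)
  have even_free: "compactly_uniform_limit (scaled_even Q) (\<lambda>x. sqrt_bessel_J (- 1 / 2) x)"
    if "own_ratio 0 M0 M1 lam \<longlonglongrightarrow> 0"
    using scaled_limit_free[OF _ even that cross0] by (simp add: scaled_even_eq)
  have even_constrained: "compactly_uniform_limit (scaled_even Q) (\<lambda>x. - sqrt_bessel_J (3 / 2) x)"
    if "own_ratio 0 M0 M1 lam \<longlonglongrightarrow> 1"
    using scaled_limit_constrained[OF _ even that cross0] by (simp add: scaled_even_eq)
  have odd_free: "compactly_uniform_limit (scaled_odd Q) (\<lambda>x. sqrt_bessel_J (1 / 2) x)"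
    if "own_ratio 1 M1 M0 lam \<longlonglongrightarrow> 0"
    using scaled_limit_free[OF _ odd that cross1] by (intro compactly_uniform_limit_scaled_odd) simp
  have odd_constrained: "compactly_uniform_limit (scaled_odd Q) (\<lambda>x. - sqrt_bessel_J (5 / 2) x)"
    if "own_ratio 1 M1 M0 lam \<longlonglongrightarrow> 1"
    using scaled_limit_constrained[OF _ odd that cross1] by (intro compactly_uniform_limit_scaled_odd) simp
  have even_ratio_no_mass: "own_ratio 0 M0 M1 lam \<longlonglongrightarrow> 0" if "M0 = 0" "lam = 0"
    by (simp add: own_ratio_def[abs_def] that)
  have odd_ratio_no_mass: "own_ratio 1 M1 M0 lam \<longlonglongrightarrow> 0" if "M1 = 0" "lam = 0"
    by (simp add: own_ratio_def[abs_def] that)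
  have even_ratio_rank1: "own_ratio 0 M0 M1 lam \<longlonglongrightarrow> 0" if "rank A = 1" "lam \<noteq> 0"
    unfolding own_ratio_def[abs_def]
    by (rule own_ratio_tendsto_0[OF pos0 diag_pos rank1[OF that(1)] lam_pos(2)[OF that(2)]
          own_over_other_diag_even_tendsto])
  have even_ratio_rank2: "own_ratio 0 M0 M1 lam \<longlonglongrightarrow> 1" if "rank A = 2"
    unfolding own_ratio_def[abs_def]
    by (rule own_ratio_tendsto_1_definite[OF pos0 diag_pos rank2[OF that] s0 t0])
  have even_ratio_diagonal: "own_ratio 0 M0 M1 lam \<longlonglongrightarrow> 1" if "rank A = 1" "lam = 0" "M0 > 0"
  proof -
    have "M1 = 0" using rank1 that by simp
    then show ?thesis unfolding own_ratio_def[abs_def]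
      by (intro own_ratio_tendsto_1_only[OF pos0 diag_pos that(3) _ s0])
  qed
  have odd_ratio_mass: "own_ratio 1 M1 M0 lam \<longlonglongrightarrow> 1" if "M1 > 0"
    unfolding own_ratio_def[abs_def]
  proof (rule own_ratio_tendsto_1_dominant[OF pos1 diag_pos that s1])
    have "(\<lambda>n. diag_const 0 / diag_const 1 * inverse (real n)) \<longlonglongrightarrow> diag_const 0 / diag_const 1 * 0"
      by (intro tendsto_mult tendsto_const lim_inverse_n)
    then have "(\<lambda>n. diag_const 0 / diag_const 1 * inverse (real n)) \<longlonglongrightarrow> 0" by simp
    moreover have "\<forall>\<^sub>F n in sequentially. diag_const 0 / diag_const 1 * inverse (real n)
        = other_diag 1 n / own_diag 1 n"
      by (rule eventually_sequentiallyI[of 1]) (subst other_over_own_diag_odd, simp_all add: divide_inverse)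
    ultimately show "(\<lambda>n. other_diag 1 n / own_diag 1 n) \<longlonglongrightarrow> 0" by (rule Lim_transform_eventually)
  qed
  have M1_pos: "M1 > 0" if "rank A = 2"
    using rank2[OF that] pos0(2) by (cases "M1 = 0") auto
  show ?thesis
    by (intro conjI impI; (elim conjE)?)
      (rule even_free even_constrained odd_free odd_constrained;
        rule even_ratio_no_mass odd_ratio_no_mass even_ratio_rank1 even_ratio_rank2
          even_ratio_diagonal odd_ratio_mass;
        (assumption | rule M1_pos lam_pos, assumption)?)+
qed

end
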